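(* Let $k$ and $c$ be positive integers, and let $f(k,c) = 8k^{2}c + 10kc - 4k + 2c + 1$. Let $G$ be a finite simple graph of order $n \ge f(k,c)$. If $\sigma_{2}(G) \ge n$, then $G$ can be partitioned into $k$ $c$-chorded cycles, i.e., $G$ contains $k$ pairwise vertex-disjoint $c$-chorded cycles $C_{1},\dots,C_{k}$ with $\bigcup_{p=1}^{k} V(C_{p}) = V(G)$.
   Context: For a graph $G$, $\sigma_{2}(G)$ denotes the minimum of $d_{G}(u)+d_{G}(v)$ over all pairs of distinct non-adjacent vertices $u,v$ of $G$; if $G$ is complete, $\sigma_{2}(G)=+\infty$. For an integer $c \ge 1$, a cycle $C$ in $G$ is a $c$-chorded cycle if $|E(G[V(C)]) \setminus E(C)| \ge c$, where $G[X]$ is the subgraph induced by $X$; edges of $E(G[V(C)]) \setminus E(C)$ are called chords of $C$. *)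

theory Defs
  imports Main "HOL-Library.Extended_Nat"
begin

definition simple_graph :: "'a set \<Rightarrow> 'a set set \<Rightarrow> bool" where
  "simple_graph V E \<longleftrightarrow> finite V \<and> (\<forall>e\<in>E. e \<subseteq> V \<and> card e = 2)"

definition degree :: "'a set \<Rightarrow> 'a set set \<Rightarrow> 'a \<Rightarrow> nat" where
  "degree V E v = card {u \<in> V. {u, v} \<in> E}"

text \<open>sigma_2: minimum degree sum over distinct non-adjacent pairs; infinity if complete
  (infimum of the empty set in enat is infinity).\<close>
definition sigma2 :: "'a set \<Rightarrow> 'a set set \<Rightarrow> enat" where
  "sigma2 V E = (INF p \<in> {(u, v). u \<in> V \<and> v \<in> V \<and> u \<noteq> v \<and> {u, v} \<notin> E}.
                    enat (degree V E (fst p) + degree V E (snd p)))"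

definition is_cycle :: "'a set \<Rightarrow> 'a set set \<Rightarrow> 'a list \<Rightarrow> bool" where
  "is_cycle V E xs \<longleftrightarrow> length xs \<ge> 3 \<and> distinct xs \<and> set xs \<subseteq> V \<and>
     (\<forall>i < length xs. {xs ! i, xs ! ((i + 1) mod length xs)} \<in> E)"

definition cycle_edges :: "'a list \<Rightarrow> 'a set set" where
  "cycle_edges xs = {{xs ! i, xs ! ((i + 1) mod length xs)} | i. i < length xs}"

definition chords :: "'a set set \<Rightarrow> 'a list \<Rightarrow> 'a set set" where
  "chords E xs = {e \<in> E. e \<subseteq> set xs} - cycle_edges xs"

definition c_chorded_cycle :: "nat \<Rightarrow> 'a set \<Rightarrow> 'a set set \<Rightarrow> 'a list \<Rightarrow> bool" where
  "c_chorded_cycle c V E xs \<longleftrightarrow> is_cycle V E xs \<and> card (chords E xs) \<ge> c"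

definition f_bound :: "nat \<Rightarrow> nat \<Rightarrow> int" where
  "f_bound k c = 8 * int k ^ 2 * int c + 10 * int k * int c - 4 * int k + 2 * int c + 1"

end

(*
  Call a vertex set good if it spans a Hamiltonian cycle and at least c more edges than it has
  vertices. A Hamiltonian set containing a good set is good.

  Let D = max (2ck + 2c + 3) (ck + 3k), so that (2k + 1) D <= n for k >= 2.

  If some vertex x has degree below D, its non-neighbours are adjacent to almost everything, so any
  2D of them are good by Ore's theorem. Cut k - 1 such sets out of a Hamiltonian cycle, using only
  vertices whose two cycle neighbours are again non-neighbours of x; by the Bondy-Chvatal closure
  the remainder is still Hamiltonian, and it is the last cycle.

  If all degrees are at least D, greedily choosing an apex with c + 2 neighbours on a piece of a
  Hamiltonian path gives k disjoint c-chorded cycles. Take such a family with maximal coverage and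
  let R be the uncovered set. No vertex of R can be inserted into a cycle, so R satisfies Ore's
  condition. Extend a Hamiltonian path of R by one of the cycles, C, opened at a neighbour of the
  start of that path, and peel vertices off the C end: each one closes the path to a cycle or is
  insertible into another cycle of the family. If R has at least 2c + 4 vertices it is itself good,
  so C may dissolve completely. Otherwise some x in R has at least 2c + 1 neighbours on some C, and
  one of the gaps between consecutive neighbours avoids the at most 2c ends of c chosen chords; only
  this gap is peeled off, after which x closes it. Either way the coverage increases.
*)
theory Submission
  imports Defs
begin

subsection \<open>Hamiltonian cycles, closure and Ore's theorem\<close>

text \<open>Stated for an arbitrary relation, since it also serves for adjacency with added pairs,
  for adjacency off a set of chosen chords, and for pairs not both adjacent to a given
  vertex.\<close>

definition cyc :: "('a \<Rightarrow> 'a \<Rightarrow> bool) \<Rightarrow> 'a list \<Rightarrow> bool" where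
  "cyc R xs \<longleftrightarrow> 3 \<le> length xs \<and> distinct xs \<and> successively R xs \<and> R (last xs) (hd xs)"

definition nbrs :: "('a \<Rightarrow> 'a \<Rightarrow> bool) \<Rightarrow> 'a set \<Rightarrow> 'a \<Rightarrow> 'a set" where
  "nbrs R X u = {v \<in> X. R u v}"

lemma Suc_mod_eq: "i < n \<Longrightarrow> (i + 1) mod n = (if Suc i < n then Suc i else 0)"
  by (cases "Suc i = n") auto

lemma cyc_nth:
  "cyc R xs \<longleftrightarrow> 3 \<le> length xs \<and> distinct xs \<and> (\<forall>i < length xs. R (xs ! i) (xs ! ((i + 1) mod length xs)))"
proof (cases "3 \<le> length xs")
  case True
  have "successively R xs \<and> R (last xs) (hd xs) \<longleftrightarrow> (\<forall>i < length xs. R (xs ! i) (xs ! ((i + 1) mod length xs)))"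
    (is "?L \<longleftrightarrow> ?R")
  proof
    assume L: ?L
    show ?R
    proof (intro allI impI)
      fix i assume i: "i < length xs"
      show "R (xs ! i) (xs ! ((i + 1) mod length xs))"
      proof (cases "Suc i < length xs")
        case True
        then show ?thesis using L by (simp add: successively_conv_nth)
      next
        case False
        then have "i = length xs - 1" "(i + 1) mod length xs = 0" using i Suc_mod_eq[OF i] by auto
        then show ?thesis using L True by (metis hd_conv_nth last_conv_nth list.size(3) not_numeral_le_zero)
      qed
    qed
  next
    assume R: ?R
    have "successively R xs" unfolding successively_conv_nth
      using R by (metis Suc_eq_plus1 Suc_lessD mod_less)
    moreover have "R (last xs) (hd xs)"
    proof -
      have "xs \<noteq> []" "length xs - 1 < length xs" using True by auto
      moreover have "(length xs - 1 + 1) mod length xs = 0" using True by (subst Suc_mod_eq) auto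
      ultimately show ?thesis using R by (metis hd_conv_nth last_conv_nth)
    qed
    ultimately show ?L by simp
  qed
  then show ?thesis by (auto simp: cyc_def)
qed (simp add: cyc_def)

lemma cyc_rotate: "cyc R (xs @ ys) \<Longrightarrow> cyc R (ys @ xs)"
  by (cases "xs = []"; cases "ys = []") (auto simp: cyc_def successively_append_iff)

lemma cyc_mono:
  "cyc R xs \<Longrightarrow> (\<And>a b. a \<in> set xs \<Longrightarrow> b \<in> set xs \<Longrightarrow> R a b \<Longrightarrow> Q a b) \<Longrightarrow> cyc Q xs"
  unfolding cyc_nth by (metis length_pos_if_in_set mod_less_divisor nth_mem)

text \<open>Lets a cyclic list be cut at any chosen edge, which becomes the wrap-around step of
  \<open>qs @ ps\<close>.\<close>

lemma rotate_to_consecutive: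
  assumes "i < length xs"
  obtains ps qs where "xs = ps @ qs" "last (qs @ ps) = xs ! i" "hd (qs @ ps) = xs ! ((i + 1) mod length xs)"
proof (cases "Suc i < length xs")
  case True
  show ?thesis
  proof (rule that)
    show "xs = take (Suc i) xs @ drop (Suc i) xs" by simp
    show "last (drop (Suc i) xs @ take (Suc i) xs) = xs ! i"
      using assms by (simp add: take_Suc_conv_app_nth)
    show "hd (drop (Suc i) xs @ take (Suc i) xs) = xs ! ((i + 1) mod length xs)"
      using True by (simp add: hd_drop_conv_nth)
  qed
next
  case False
  then have i: "i = length xs - 1" "(i + 1) mod length xs = 0" "xs \<noteq> []" using assms Suc_mod_eq[OF assms] by auto
  show ?thesis
    by (rule that[of "[]" xs]) (simp_all add: i last_conv_nth hd_conv_nth)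
qed

text \<open>Ore's crossing argument: the neighbours of the two ends put at least n marks on the n -
  1 edges of the path, so some edge is marked from both ends and can be exchanged for two edges to
  the ends.\<close>

lemma path_crossing:
  assumes sym: "symp R" and irr: "irreflp R"
    and xs: "successively R xs" "distinct xs" "3 \<le> length xs"
    and deg: "card (nbrs R (set xs) (hd xs)) + card (nbrs R (set xs) (last xs)) \<ge> length xs"
  obtains ys where "cyc R ys" "set ys = set xs"
proof -
  let ?n = "length xs"
  have ne: "xs \<noteq> []" using xs by auto
  \<comment> \<open>Index \<open>i\<close> stands for the path edge from \<open>xs ! i\<close> to
    \<open>xs ! Suc i\<close>: \<open>S\<close> marks it if its second vertex is adjacent to the
    start, \<open>T\<close> if its first vertex is adjacent to the end. By irreflexivity every
    neighbour of an end yields a mark.\<close>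
  define S where "S = {i. i < ?n - 1 \<and> R (hd xs) (xs ! Suc i)}"
  define T where "T = {i. i < ?n - 1 \<and> R (last xs) (xs ! i)}"
  have fin: "finite S" "finite T" by (auto simp: S_def T_def)
  have "nbrs R (set xs) (hd xs) \<subseteq> (\<lambda>i. xs ! Suc i) ` S"
  proof
    fix v assume v: "v \<in> nbrs R (set xs) (hd xs)"
    then obtain j where j: "j < ?n" "xs ! j = v" by (auto simp: nbrs_def in_set_conv_nth)
    have "j \<noteq> 0" using v j irr ne by (metis (mono_tags, lifting) CollectD hd_conv_nth irreflpD nbrs_def)
    then show "v \<in> (\<lambda>i. xs ! Suc i) ` S" using v j
      by (intro image_eqI[of _ _ "j - 1"]) (auto simp: S_def nbrs_def)
  qed
  then have S: "card (nbrs R (set xs) (hd xs)) \<le> card S" by (rule surj_card_le[OF fin(1)])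
  have "nbrs R (set xs) (last xs) \<subseteq> (\<lambda>i. xs ! i) ` T"
  proof
    fix v assume v: "v \<in> nbrs R (set xs) (last xs)"
    then obtain j where j: "j < ?n" "xs ! j = v" by (auto simp: nbrs_def in_set_conv_nth)
    have "j \<noteq> ?n - 1" using v j irr ne by (metis (mono_tags, lifting) CollectD last_conv_nth irreflpD nbrs_def)
    then show "v \<in> (\<lambda>i. xs ! i) ` T" using v j
      by (intro image_eqI[of _ _ j]) (auto simp: T_def nbrs_def)
  qed
  then have T: "card (nbrs R (set xs) (last xs)) \<le> card T" by (rule surj_card_le[OF fin(2)])
  have "S \<inter> T \<noteq> {}"
  proof
    assume "S \<inter> T = {}"
    then have "card S + card T = card (S \<union> T)" using fin by (simp add: card_Un_disjoint)
    also have "\<dots> \<le> card {..<?n - 1}" by (rule card_mono) (auto simp: S_def T_def)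
    finally show False using S T deg xs(3) by simp
  qed
  then obtain i where i: "i < ?n - 1" "R (hd xs) (xs ! Suc i)" "R (last xs) (xs ! i)"
    by (auto simp: S_def T_def)
  define ps qs where "ps = take (Suc i) xs" and "qs = drop (Suc i) xs"
  have xs_eq: "xs = ps @ qs" by (simp add: ps_def qs_def)
  have nel: "ps \<noteq> []" "qs \<noteq> []" using i ne by (auto simp: ps_def qs_def)
  have ends: "last ps = xs ! i" "hd qs = xs ! Suc i"
    using i by (auto simp: ps_def qs_def take_Suc_conv_app_nth hd_drop_conv_nth)
  have hl: "hd xs = hd ps" "last xs = last qs" using nel by (auto simp: xs_eq)
  have R': "R b a" if "R a b" for a b using that sym by (simp add: sympD)
  \<comment> \<open>Forward to \<open>xs ! i\<close>, across to the last vertex, backward to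
    \<open>xs ! Suc i\<close>, and home to the start.\<close>
  have "cyc R (ps @ rev qs)"
    unfolding cyc_def
  proof (intro conjI)
    show "successively R (ps @ rev qs)"
      using xs(1) nel i ends hl R'
      by (auto simp: xs_eq successively_append_iff hd_rev successively_rev intro: successively_mono)
    show "R (last (ps @ rev qs)) (hd (ps @ rev qs))"
      using nel i ends hl R' by (simp add: last_rev)
  qed (use xs in \<open>auto simp: xs_eq\<close>)
  moreover have "set (ps @ rev qs) = set xs" by (simp add: xs_eq)
  ultimately show ?thesis by (rule that)
qed

text \<open>Bondy-Chvatal closure, by induction on the number of missing pairs: one pair is added to
  \<open>R\<close>; if the cycle found for the larger relation uses it, opening the cycle there
  leaves a Hamiltonian \<open>R\<close>-path to which \<open>path_crossing\<close> applies.\<close>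

lemma cyc_closure:
  assumes "symp R" "irreflp R" "finite X" "symp R'"
    and "cyc R' xs" "set xs = X"
    and "\<And>u v. u \<in> X \<Longrightarrow> v \<in> X \<Longrightarrow> u \<noteq> v \<Longrightarrow> R' u v \<Longrightarrow> \<not> R u v \<Longrightarrow>
           card (nbrs R X u) + card (nbrs R X v) \<ge> card X"
  shows "\<exists>ys. cyc R ys \<and> set ys = X"
  using assms
proof (induction "card {(u, v). u \<in> X \<and> v \<in> X \<and> R' u v \<and> \<not> R u v}" arbitrary: R rule: less_induct)
  case less
  show ?case
  proof (cases "\<forall>u\<in>X. \<forall>v\<in>X. u \<noteq> v \<longrightarrow> R' u v \<longrightarrow> R u v")
    case True
    have "cyc R xs" unfolding cyc_nth
    proof (intro conjI allI impI)
      show "3 \<le> length xs" "distinct xs" using less.prems(5) by (auto simp: cyc_nth)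
      fix i assume i: "i < length xs"
      have "(i + 1) mod length xs \<noteq> i"
        using Suc_mod_eq[OF i] i \<open>3 \<le> length xs\<close> by auto
      moreover have "(i + 1) mod length xs < length xs" using i by (intro mod_less_divisor) auto
      ultimately have "xs ! i \<noteq> xs ! ((i + 1) mod length xs)" using i \<open>distinct xs\<close>
        by (simp add: nth_eq_iff_index_eq)
      then show "R (xs ! i) (xs ! ((i + 1) mod length xs))"
        using True i less.prems(5,6) \<open>(i + 1) mod length xs < length xs\<close> by (auto simp: cyc_nth)
    qed
    then show ?thesis using less.prems by auto
  next
    case False
    then obtain u v where uv: "u \<in> X" "v \<in> X" "u \<noteq> v" "R' u v" "\<not> R u v" by auto
    define R1 where "R1 = (\<lambda>a b. R a b \<or> (a = u \<and> b = v) \<or> (a = v \<and> b = u))"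
    have sym1: "symp R1" using less.prems(1) by (auto simp: R1_def symp_def)
    have irr1: "irreflp R1" using less.prems(2) uv by (auto simp: R1_def irreflp_def)
    \<comment> \<open>Adding a pair only raises degrees, so the degree hypothesis survives for
      \<open>R1\<close>.\<close>
    have nb: "card (nbrs R X a) \<le> card (nbrs R1 X a)" for a
      using less.prems(3) by (intro card_mono) (auto simp: nbrs_def R1_def)
    have "\<exists>ys. cyc R1 ys \<and> set ys = X"
    proof (rule less.hyps)
      show "card {(u, v). u \<in> X \<and> v \<in> X \<and> R' u v \<and> \<not> R1 u v} < card {(u, v). u \<in> X \<and> v \<in> X \<and> R' u v \<and> \<not> R u v}"
      proof (rule psubset_card_mono)
        show "finite {(u, v). u \<in> X \<and> v \<in> X \<and> R' u v \<and> \<not> R u v}"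
          by (rule finite_subset[of _ "X \<times> X"]) (use less.prems(3) in auto)
        have "(u, v) \<in> {(u, v). u \<in> X \<and> v \<in> X \<and> R' u v \<and> \<not> R u v}"
          "(u, v) \<notin> {(u, v). u \<in> X \<and> v \<in> X \<and> R' u v \<and> \<not> R1 u v}"
          using uv by (auto simp: R1_def)
        then show "{(u, v). u \<in> X \<and> v \<in> X \<and> R' u v \<and> \<not> R1 u v} \<subset> {(u, v). u \<in> X \<and> v \<in> X \<and> R' u v \<and> \<not> R u v}"
          by (auto simp: R1_def)
      qed
      fix a b assume ab: "a \<in> X" "b \<in> X" "a \<noteq> b" "R' a b" "\<not> R1 a b"
      then have "\<not> R a b" by (auto simp: R1_def)
      from less.prems(7)[OF ab(1-4) this] show "card X \<le> card (nbrs R1 X a) + card (nbrs R1 X b)"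
        using nb[of a] nb[of b] by linarith
    qed (use less.prems sym1 irr1 in auto)
    then obtain ys where ys: "cyc R1 ys" "set ys = X" by auto
    show ?thesis
    proof (cases "cyc R ys")
      case True then show ?thesis using ys by auto
    next
      case False
      then obtain i where i: "i < length ys" "\<not> R (ys ! i) (ys ! ((i + 1) mod length ys))"
        using ys by (auto simp: cyc_nth)
      obtain ps qs where pq: "ys = ps @ qs" "last (qs @ ps) = ys ! i"
        "hd (qs @ ps) = ys ! ((i + 1) mod length ys)"
        using rotate_to_consecutive[OF i(1)] .
      define zs where "zs = qs @ ps"
      have z: "cyc R1 zs" "set zs = X" using ys pq cyc_rotate[of R1 ps qs] by (auto simp: zs_def)
      have l3: "3 \<le> length zs" and dz: "distinct zs" using z by (auto simp: cyc_def)
      have ne: "zs \<noteq> []" using l3 by auto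
      have "R1 (last zs) (hd zs)" "\<not> R (last zs) (hd zs)" using z i pq by (auto simp: zs_def cyc_def)
      then have lh: "(last zs = u \<and> hd zs = v) \<or> (last zs = v \<and> hd zs = u)" by (auto simp: R1_def)
      have "successively R zs"
        unfolding successively_conv_nth
      proof (intro allI impI)
        fix j assume j: "Suc j < length zs"
        have "R1 (zs ! j) (zs ! Suc j)" using z j by (auto simp: cyc_def successively_conv_nth)
        \<comment> \<open>On at least three distinct vertices no inner step joins the two ends, so
          the added pair occurs only as the closing step.\<close>
        moreover have False
          if "(zs ! j = last zs \<and> zs ! Suc j = hd zs) \<or> (zs ! j = hd zs \<and> zs ! Suc j = last zs)"
          using that j dz l3 ne by (auto simp: last_conv_nth hd_conv_nth nth_eq_iff_index_eq)
        ultimately show "R (zs ! j) (zs ! Suc j)" using lh by (auto simp: R1_def)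
      qed
      moreover have "card (nbrs R (set zs) (hd zs)) + card (nbrs R (set zs) (last zs)) \<ge> length zs"
        using less.prems(7)[OF uv] lh z(2) distinct_card[OF dz] by auto
      ultimately show ?thesis using path_crossing[OF less.prems(1,2) _ dz l3] z(2) by metis
    qed
  qed
qed

lemma ore_cyc:
  assumes "symp R" "irreflp R" "finite X" "3 \<le> card X"
    and "\<And>u v. u \<in> X \<Longrightarrow> v \<in> X \<Longrightarrow> u \<noteq> v \<Longrightarrow> \<not> R u v \<Longrightarrow>
           card (nbrs R X u) + card (nbrs R X v) \<ge> card X"
  shows "\<exists>ys. cyc R ys \<and> set ys = X"
proof -
  obtain xs where xs: "set xs = X" "distinct xs" using finite_distinct_list[OF assms(3)] by auto
  then have "3 \<le> length xs" using assms(4) distinct_card by fastforce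
  \<comment> \<open>The closure is taken to be the complete relation, for which any enumeration is a
    cycle.\<close>
  then have "cyc (\<lambda>_ _. True) xs" using xs by (auto simp: cyc_nth)
  from cyc_closure[OF assms(1-3) _ this xs(1)] assms(5) show ?thesis by (auto simp: symp_def)
qed

subsection \<open>Chorded cycles\<close>

lemma cycle_edges_eq:
  "cycle_edges xs = (\<lambda>i. {xs ! i, xs ! ((i + 1) mod length xs)}) ` {..<length xs}"
  by (auto simp: cycle_edges_def)

text \<open>Two indices could share an edge only by being each other's cyclic successor, which needs
  length 2.\<close>

lemma cycle_edges_inj:
  assumes "distinct xs" "3 \<le> length xs"
  shows "inj_on (\<lambda>i. {xs ! i, xs ! ((i + 1) mod length xs)}) {..<length xs}"
proof (rule inj_onI, unfold lessThan_iff)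
  let ?n = "length xs"
  fix i j assume ij: "i < ?n" "j < ?n"
    and eq: "{xs ! i, xs ! ((i + 1) mod ?n)} = {xs ! j, xs ! ((j + 1) mod ?n)}"
  have lt: "(i + 1) mod ?n < ?n" "(j + 1) mod ?n < ?n" using ij by (auto intro!: mod_less_divisor)
  have "i = j \<or> (i = (j + 1) mod ?n \<and> j = (i + 1) mod ?n)"
    using eq ij lt assms(1) by (auto simp: doubleton_eq_iff nth_eq_iff_index_eq)
  then show "i = j" using ij assms(2) Suc_mod_eq[OF ij(1)] Suc_mod_eq[OF ij(2)] by (auto split: if_splits)
qed

lemma card_cycle_edges: "distinct xs \<Longrightarrow> 3 \<le> length xs \<Longrightarrow> card (cycle_edges xs) = length xs"
  unfolding cycle_edges_eq using card_image[OF cycle_edges_inj] by fastforce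

section \<open>Chord counts, degrees and vertex insertion in a finite graph\<close>

locale graph =
  fixes V :: "'a set" and E :: "'a set set" and c :: nat
  assumes simple: "simple_graph V E"
begin

abbreviation adj :: "'a \<Rightarrow> 'a \<Rightarrow> bool" where "adj u v \<equiv> {u, v} \<in> E"
abbreviation deg :: "'a set \<Rightarrow> 'a \<Rightarrow> nat" where "deg X u \<equiv> card (nbrs adj X u)"
abbreviation cc :: "'a list \<Rightarrow> bool" where "cc \<equiv> c_chorded_cycle c V E"

definition induced :: "'a set \<Rightarrow> 'a set set" where
  "induced X = {e \<in> E. e \<subseteq> X}"

text \<open>Expresses that \<open>w\<close> cannot be inserted between consecutive vertices of the
  cycle; going through \<open>cyc\<close> makes rotation invariance an instance of
  \<open>cyc_rotate\<close>.\<close>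

definition avoids :: "'a \<Rightarrow> 'a list \<Rightarrow> bool" where
  "avoids w xs \<longleftrightarrow> cyc (\<lambda>a b. \<not> (adj w a \<and> adj w b)) xs"

lemma finV: "finite V" using simple by (simp add: simple_graph_def)
lemma finE: "finite E" using simple by (auto simp: simple_graph_def intro: finite_subset[of E "Pow V"])
lemma adj_sym: "symp adj" by (simp add: symp_def insert_commute)
lemma adj_commute: "adj u v = adj v u" by (simp add: insert_commute)
lemma adj_irrefl: "irreflp adj" using simple by (auto simp: simple_graph_def irreflp_def)
lemma adj_neq: "adj u v \<Longrightarrow> u \<noteq> v" using adj_irrefl by (metis irreflpD)
lemma adj_V: "adj u v \<Longrightarrow> u \<in> V" "adj u v \<Longrightarrow> v \<in> V" using simple by (auto simp: simple_graph_def)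
lemma fin_induced: "finite (induced X)" using finE by (simp add: induced_def)

lemma induced_mono: "X \<subseteq> Y \<Longrightarrow> induced X \<subseteq> induced Y" by (auto simp: induced_def)

lemma deg_mono: "X \<subseteq> Y \<Longrightarrow> finite Y \<Longrightarrow> deg X u \<le> deg Y u"
  by (intro card_mono) (auto simp: nbrs_def)

lemma deg_Un: "finite X \<Longrightarrow> finite Y \<Longrightarrow> X \<inter> Y = {} \<Longrightarrow> deg (X \<union> Y) u = deg X u + deg Y u"
proof -
  assume a: "finite X" "finite Y" "X \<inter> Y = {}"
  have "nbrs adj (X \<union> Y) u = nbrs adj X u \<union> nbrs adj Y u" by (auto simp: nbrs_def)
  moreover have "card (nbrs adj X u \<union> nbrs adj Y u) = deg X u + deg Y u"
    by (rule card_Un_disjoint) (use a in \<open>auto simp: nbrs_def\<close>)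
  ultimately show ?thesis by simp
qed

lemma deg_UN:
  assumes "finite J" "\<And>j. j \<in> J \<Longrightarrow> finite (D j)" "\<And>i j. i \<in> J \<Longrightarrow> j \<in> J \<Longrightarrow> i \<noteq> j \<Longrightarrow> D i \<inter> D j = {}"
  shows "deg (\<Union>j\<in>J. D j) u = (\<Sum>j\<in>J. deg (D j) u)"
proof -
  have "nbrs adj (\<Union>j\<in>J. D j) u = (\<Union>j\<in>J. nbrs adj (D j) u)" by (auto simp: nbrs_def)
  then show ?thesis using assms by (simp, intro card_UN_disjoint) (fastforce simp: nbrs_def)+
qed

lemma deg_le: "finite X \<Longrightarrow> deg X u \<le> card X"
  by (intro card_mono) (auto simp: nbrs_def)

lemma deg_less: "finite X \<Longrightarrow> u \<in> X \<Longrightarrow> deg X u < card X"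
  using adj_neq by (intro psubset_card_mono) (fastforce simp: nbrs_def)+

lemma cyc_subset_V: "cyc adj xs \<Longrightarrow> set xs \<subseteq> V"
  unfolding cyc_nth by (metis adj_V(1) in_set_conv_nth subsetI)

lemma is_cycle_iff: "is_cycle V E xs \<longleftrightarrow> cyc adj xs"
  using cyc_subset_V by (auto simp: is_cycle_def cyc_nth)

lemma cycle_edges_subset: "cyc adj xs \<Longrightarrow> cycle_edges xs \<subseteq> induced (set xs)"
  unfolding cyc_nth cycle_edges_eq induced_def
  by (auto intro!: nth_mem mod_less_divisor)

text \<open>The cycle edges are exactly \<open>length xs\<close> of the induced edges. Hence for a
  Hamiltonian set the number of chords depends on the set alone, not on the chosen cycle.\<close>

lemma cc_iff: "cc xs \<longleftrightarrow> cyc adj xs \<and> card (induced (set xs)) \<ge> length xs + c"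
proof (cases "cyc adj xs")
  case True
  then have "card (chords E xs) = card (induced (set xs)) - length xs"
    unfolding chords_def induced_def[symmetric]
    using cycle_edges_subset[OF True] fin_induced card_cycle_edges[of xs]
    by (subst card_Diff_subset) (auto intro: finite_subset simp: cyc_def)
  moreover have "card (induced (set xs)) \<ge> length xs"
    using cycle_edges_subset[OF True] True card_mono[OF fin_induced] card_cycle_edges[of xs] by (metis cyc_def)
  ultimately show ?thesis using True by (auto simp: c_chorded_cycle_def is_cycle_iff)
qed (simp add: c_chorded_cycle_def is_cycle_iff)

lemma cc_cyc: "cc xs \<Longrightarrow> cyc adj xs" by (simp add: cc_iff)
lemma cc_distinct: "cc xs \<Longrightarrow> distinct xs" by (simp add: cc_iff cyc_def)
lemma cc_card: "cc xs \<Longrightarrow> card (set xs) = length xs" by (simp add: cc_distinct distinct_card)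
lemma cc_V: "cc xs \<Longrightarrow> set xs \<subseteq> V" using cyc_subset_V cc_cyc by auto

text \<open>Passing to a larger Hamiltonian vertex set never destroys chords: each new vertex pays for
  itself with the cycle edge that leaves it.\<close>

lemma cc_extend:
  assumes xs: "cyc adj xs" and Y: "Y \<subseteq> set xs" "card (induced Y) \<ge> card Y + c"
  shows "cc xs"
proof -
  let ?n = "length xs"
  let ?e = "\<lambda>i. {xs ! i, xs ! ((i + 1) mod ?n)}"
  let ?I = "{i. i < ?n \<and> xs ! i \<notin> Y}"
  have d: "distinct xs" "3 \<le> ?n" using xs by (auto simp: cyc_def)
  have "inj_on ?e ?I" by (rule inj_on_subset[OF cycle_edges_inj[OF d]]) auto
  then have e: "card (?e ` ?I) = card ?I" by (rule card_image)
  have "(\<lambda>i. xs ! i) ` ?I = set xs - Y" by (auto simp: set_conv_nth)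
  moreover have "inj_on (\<lambda>i. xs ! i) ?I" using d by (auto simp: inj_on_def nth_eq_iff_index_eq)
  ultimately have I: "card ?I = card (set xs - Y)" by (metis card_image)
  have "?e ` ?I \<subseteq> cycle_edges xs" unfolding cycle_edges_eq by auto
  then have "?e ` ?I \<union> induced Y \<subseteq> induced (set xs)"
    using cycle_edges_subset[OF xs] induced_mono[OF Y(1)] by blast
  then have "card (?e ` ?I \<union> induced Y) \<le> card (induced (set xs))" by (rule card_mono[OF fin_induced])
  moreover have "card (?e ` ?I \<union> induced Y) = card (?e ` ?I) + card (induced Y)"
    by (rule card_Un_disjoint[OF _ fin_induced]) (auto simp: induced_def)
  moreover have "card (set xs - Y) = ?n - card Y" "card Y \<le> ?n"
    using Y(1) distinct_card[OF d(1)] card_mono[OF finite_set Y(1)]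
    by (simp_all add: card_Diff_subset finite_subset)
  ultimately show ?thesis using Y e I xs by (simp add: cc_iff)
qed

text \<open>Of the edges at \<open>v\<close>, the cycle itself uses at most two; the others are
  chords.\<close>

lemma cc_fan:
  assumes xs: "cyc adj xs" and v: "v \<in> set xs" "deg (set xs) v \<ge> c + 2"
  shows "cc xs"
proof -
  let ?n = "length xs"
  let ?e = "\<lambda>i. {xs ! i, xs ! ((i + 1) mod ?n)}"
  have d: "distinct xs" "3 \<le> ?n" using xs by (auto simp: cyc_def)
  define S where "S = (\<lambda>u. {v, u}) ` nbrs adj (set xs) v"
  have fS: "finite S" by (simp add: S_def nbrs_def)
  have S: "card S = deg (set xs) v" unfolding S_def
    by (rule card_image) (auto simp: inj_on_def doubleton_eq_iff)
  have sub: "S \<subseteq> induced (set xs)" using v(1) by (auto simp: S_def nbrs_def induced_def)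
  obtain i0 where i0: "i0 < ?n" "xs ! i0 = v" using v(1) by (auto simp: in_set_conv_nth)
  \<comment> \<open>The cyclic predecessor of \<open>i0\<close>, giving the other cycle edge at
    \<open>v\<close>.\<close>
  define i1 where "i1 = (if i0 = 0 then ?n - 1 else i0 - 1)"
  have "S \<inter> cycle_edges xs \<subseteq> {?e i0, ?e i1}"
  proof
    fix e assume e: "e \<in> S \<inter> cycle_edges xs"
    then obtain i where i: "i < ?n" "e = ?e i" by (auto simp: cycle_edges_eq)
    have "(i + 1) mod ?n < ?n" using i by (intro mod_less_divisor) auto
    moreover have "xs ! i = v \<or> xs ! ((i + 1) mod ?n) = v" using e i by (auto simp: S_def doubleton_eq_iff)
    ultimately have "i = i0 \<or> (i + 1) mod ?n = i0" using i i0 d by (auto simp: nth_eq_iff_index_eq)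
    then have "i = i0 \<or> i = i1" using i i0 Suc_mod_eq[OF i(1)] by (auto simp: i1_def split: if_splits)
    then show "e \<in> {?e i0, ?e i1}" using i by auto
  qed
  then have "card (S \<inter> cycle_edges xs) \<le> card {?e i0, ?e i1}" by (intro card_mono) auto
  also have "\<dots> \<le> 2" by (simp add: card_insert_if)
  finally have "card (S \<inter> cycle_edges xs) \<le> 2" .
  moreover have "card S + card (cycle_edges xs) = card (S \<union> cycle_edges xs) + card (S \<inter> cycle_edges xs)"
    by (rule card_Un_Int) (auto simp: fS cycle_edges_eq)
  moreover have "card (S \<union> cycle_edges xs) \<le> card (induced (set xs))"
    using sub cycle_edges_subset[OF xs] by (intro card_mono[OF fin_induced]) auto
  ultimately show ?thesis using S v(2) card_cycle_edges[OF d] xs by (simp add: cc_iff)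
qed

text \<open>Ore's theorem gives the cycle. A vertex of degree at least \<open>c + 2\<close> comes
  from a non-adjacent pair with degree sum at least \<open>2 * c + 4\<close>, or from completeness;
  then \<open>cc_fan\<close> supplies the chords.\<close>

lemma ore_cc:
  assumes X: "X \<subseteq> V" "2 * c + 4 \<le> card X"
    and ore: "\<And>u v. u \<in> X \<Longrightarrow> v \<in> X \<Longrightarrow> u \<noteq> v \<Longrightarrow> \<not> adj u v \<Longrightarrow> card X \<le> deg X u + deg X v"
  obtains xs where "cc xs" "set xs = X"
proof -
  have fin: "finite X" using X(1) finV finite_subset by auto
  obtain xs where xs: "cyc adj xs" "set xs = X"
    using ore_cyc[OF adj_sym adj_irrefl fin _ ore] X(2) by auto
  have "\<exists>v\<in>X. deg X v \<ge> c + 2"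
  proof (cases "\<exists>u\<in>X. \<exists>v\<in>X. u \<noteq> v \<and> \<not> adj u v")
    case True
    then obtain u v where uv: "u \<in> X" "v \<in> X" "u \<noteq> v" "\<not> adj u v" by auto
    then have "deg X u \<ge> c + 2 \<or> deg X v \<ge> c + 2" using ore[OF uv] X(2) by linarith
    then show ?thesis using uv by auto
  next
    case False
    obtain v where v: "v \<in> X" using X(2) by fastforce
    then have "X - {v} \<subseteq> nbrs adj X v" using False by (auto simp: nbrs_def)
    then have "card (X - {v}) \<le> deg X v" by (intro card_mono) (auto simp: fin nbrs_def)
    then show ?thesis using v X(2) fin by (intro bexI[of _ v]) auto
  qed
  then show ?thesis using cc_fan[OF xs(1)] xs(2) that by metis
qed

text \<open>The positions of the neighbours of \<open>w\<close> and their cyclic successors are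
  disjoint and equally many.\<close>

lemma avoids_deg:
  assumes "avoids w xs"
  shows "2 * deg (set xs) w \<le> length xs"
proof -
  let ?n = "length xs"
  let ?I = "{i. i < ?n \<and> adj w (xs ! i)}"
  let ?s = "\<lambda>i. (i + 1) mod ?n"
  have d: "distinct xs" "3 \<le> ?n" and av: "\<And>i. i < ?n \<Longrightarrow> \<not> (adj w (xs ! i) \<and> adj w (xs ! ?s i))"
    using assms by (auto simp: avoids_def cyc_nth)
  have im: "(\<lambda>i. xs ! i) ` ?I = nbrs adj (set xs) w" by (auto simp: set_conv_nth nbrs_def)
  have "inj_on (\<lambda>i. xs ! i) ?I" using d by (auto simp: inj_on_def nth_eq_iff_index_eq)
  from card_image[OF this] have I: "card ?I = deg (set xs) w" unfolding im by (rule sym)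
  have "inj_on ?s ?I"
  proof (rule inj_onI)
    fix i j assume ij: "i \<in> ?I" "j \<in> ?I" "?s i = ?s j"
    then have "(if Suc i < ?n then Suc i else 0) = (if Suc j < ?n then Suc j else 0)" "i < ?n" "j < ?n"
      using Suc_mod_eq[of i ?n] Suc_mod_eq[of j ?n] by simp_all
    then show "i = j" by (simp split: if_splits)
  qed
  then have sI: "card (?s ` ?I) = card ?I" by (rule card_image)
  have "card (?I \<union> ?s ` ?I) = card ?I + card (?s ` ?I)"
    using av by (intro card_Un_disjoint) auto
  moreover have "?I \<union> ?s ` ?I \<subseteq> {..<?n}" using d by (auto intro!: mod_less_divisor)
  then have "card (?I \<union> ?s ` ?I) \<le> ?n" using card_mono[of "{..<?n}"] by fastforce
  ultimately show ?thesis using I sI by simp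
qed

text \<open>Both new cycle edges contain \<open>x\<close>, so a vertex not adjacent to
  \<open>x\<close> gains no place for insertion. The last clause thus maintains the hypothesis on
  the far end of the path in \<open>absorb_prefix\<close>.\<close>

lemma cc_insert:
  assumes xs: "cc xs" and x: "x \<notin> set xs" "\<not> avoids x xs"
  obtains ys where "cc ys" "set ys = insert x (set xs)"
    "\<And>w. avoids w xs \<Longrightarrow> \<not> adj w x \<Longrightarrow> avoids w ys"
proof -
  have cyc: "cyc adj xs" using xs by (rule cc_cyc)
  obtain i where i: "i < length xs" "adj x (xs ! i)" "adj x (xs ! ((i + 1) mod length xs))"
    using x(2) cyc by (auto simp: avoids_def cyc_nth)
  obtain ps qs where pq: "xs = ps @ qs" "last (qs @ ps) = xs ! i"
    "hd (qs @ ps) = xs ! ((i + 1) mod length xs)" using rotate_to_consecutive[OF i(1)] .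
  define zs where "zs = qs @ ps"
  have sz: "set zs = set xs" by (auto simp: zs_def pq(1))
  have z: "cyc adj zs" "\<And>w. avoids w xs \<Longrightarrow> avoids w zs"
    using cyc cyc_rotate unfolding zs_def pq(1) avoids_def by blast+
  have ne: "zs \<noteq> []" using z by (auto simp: cyc_def)
  have a: "adj x (hd zs)" "adj (last zs) x" using i pq by (auto simp: zs_def insert_commute)
  have cy: "cyc adj (x # zs)" using z(1) a ne x(1) sz by (auto simp: cyc_def successively_Cons)
  show ?thesis
  proof (rule that)
    show "set (x # zs) = insert x (set xs)" using sz by simp
    have "card (induced (set xs)) \<ge> card (set xs) + c" using xs cc_card[OF xs] by (simp add: cc_iff)
    then show "cc (x # zs)" using sz by (intro cc_extend[OF cy, of "set xs"]) auto
    show "avoids w (x # zs)" if "avoids w xs" "\<not> adj w x" for w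
      using z(2)[OF that(1)] that(2) ne x(1) sz by (auto simp: avoids_def cyc_def successively_Cons)
  qed
qed

end

subsection \<open>Enlarging a family of chorded cycles\<close>

lemma cyc_rotate_hd:
  assumes "cyc R xs" "x \<in> set xs"
  obtains ys where "cyc R ys" "set ys = set xs" "hd ys = x"
proof -
  obtain as bs where "xs = as @ x # bs" using assms(2) by (auto simp: in_set_conv_decomp)
  then show ?thesis using that[of "(x # bs) @ as"] assms(1) cyc_rotate[of R as "x # bs"] by auto
qed

text \<open>Pigeonhole: the list splits into blocks, each an \<open>N\<close>-element followed by a
  run of others. Every run that meets \<open>U\<close> uses up an element of \<open>U\<close>, and
  there are more blocks than such elements. If \<open>bs\<close> is empty, the run ends where the
  cycle returns to the head.\<close>

lemma exists_gap:
  assumes "distinct xs" "xs \<noteq> [] \<Longrightarrow> N (hd xs)" "finite U" "card (U \<inter> set xs) < length (filter N xs)"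
  shows "\<exists>as y G bs. xs = as @ y # G @ bs \<and> N y \<and> (\<forall>g\<in>set G. \<not> N g \<and> g \<notin> U) \<and> (bs = [] \<or> N (hd bs))"
  using assms
proof (induction "length xs" arbitrary: xs rule: less_induct)
  case less
  then obtain y ys where xs: "xs = y # ys" by (cases xs) auto
  define G bs where "G = takeWhile (\<lambda>a. \<not> N a) ys" and "bs = dropWhile (\<lambda>a. \<not> N a) ys"
  have ys: "ys = G @ bs" by (simp add: G_def bs_def)
  have G: "\<forall>g\<in>set G. \<not> N g" unfolding G_def by (metis set_takeWhileD)
  have bs: "bs = [] \<or> N (hd bs)" unfolding bs_def using hd_dropWhile by metis
  have y: "N y" using less.prems xs by simp
  show ?case
  proof (cases "set G \<inter> U = {}")
    case True
    then show ?thesis using xs ys G bs y by (intro exI[of _ "[]"] exI[of _ y] exI[of _ G] exI[of _ bs]) auto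
  next
    case False
    then obtain g where g: "g \<in> set G" "g \<in> U" by auto
    have "g \<notin> set bs" using less.prems(1) g xs ys by auto
    then have "U \<inter> set bs \<subset> U \<inter> set xs" using g xs ys by auto
    then have lt: "card (U \<inter> set bs) < card (U \<inter> set xs)" by (intro psubset_card_mono) auto
    have "filter N G = []" using G by (simp add: filter_empty_conv)
    then have "length (filter N xs) = Suc (length (filter N bs))" using y by (simp add: xs ys)
    then have "card (U \<inter> set bs) < length (filter N bs)" using lt less.prems(4) by linarith
    moreover have "length bs < length xs" "distinct bs" using xs ys less.prems(1) by auto
    moreover have "bs \<noteq> [] \<Longrightarrow> N (hd bs)" using bs by auto
    ultimately have "\<exists>as y G bs'. bs = as @ y # G @ bs' \<and> N y \<and> (\<forall>g\<in>set G. \<not> N g \<and> g \<notin> U) \<and> (bs' = [] \<or> N (hd bs'))"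
      using less.hyps[of bs] less.prems(3) by blast
    then obtain as' y' G' bs' where
      "bs = as' @ y' # G' @ bs' \<and> N y' \<and> (\<forall>g\<in>set G'. \<not> N g \<and> g \<notin> U) \<and> (bs' = [] \<or> N (hd bs'))"
      by (elim exE)
    then show ?thesis using xs ys by (intro exI[of _ "y # G @ as'"]) auto
  qed
qed

section \<open>Exchange arguments under Ore's condition\<close>

locale ore_graph = graph +
  assumes ore: "\<And>u v. u \<in> V \<Longrightarrow> v \<in> V \<Longrightarrow> u \<noteq> v \<Longrightarrow> \<not> adj u v \<Longrightarrow> card V \<le> deg V u + deg V v"
begin

text \<open>The exchange step. The first vertex of the path either closes the path to a cycle (by the
  crossing argument on its two ends), or the degree that is missing on the path lies on the cycles
  and forces the vertex to be insertible there, as the other end is not.\<close>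

lemma absorb_prefix:
  assumes J: "finite J" "\<And>j. j \<in> J \<Longrightarrow> cc (D j)"
    and disj: "\<And>i j. i \<in> J \<Longrightarrow> j \<in> J \<Longrightarrow> i \<noteq> j \<Longrightarrow> set (D i) \<inter> set (D j) = {}"
      "\<And>j. j \<in> J \<Longrightarrow> set (D j) \<inter> set (G @ M) = {}"
    and path: "successively adj (G @ M)" "distinct (G @ M)"
    and cover: "V = (\<Union>j\<in>J. set (D j)) \<union> set (G @ M)"
    and w: "\<And>j. j \<in> J \<Longrightarrow> avoids (last M) (D j)"
    and ys: "cc ys" "set ys \<subseteq> set M"
  shows "\<exists>D' xs. (\<forall>j\<in>J. cc (D' j)) \<and> (\<forall>i\<in>J. \<forall>j\<in>J. i \<noteq> j \<longrightarrow> set (D' i) \<inter> set (D' j) = {}) \<and>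
           cc xs \<and> (\<forall>j\<in>J. set (D' j) \<inter> set xs = {}) \<and>
           V - (set M - set ys) \<subseteq> (\<Union>j\<in>J. set (D' j)) \<union> set xs"
  using J(2) disj path cover w
proof (induction G arbitrary: D)
  \<comment> \<open>With the prefix used up, \<open>ys\<close> completes the family, and only
    \<open>set M - set ys\<close> is lost.\<close>
  case Nil
  have "\<forall>j\<in>J. set (D j) \<inter> set ys = {}" using Nil.prems(3) ys(2) by fastforce
  moreover have "V - (set M - set ys) \<subseteq> (\<Union>j\<in>J. set (D j)) \<union> set ys" using Nil.prems(6) by auto
  ultimately show ?case
    using Nil.prems(1,2) ys(1) by (intro exI[of _ D] exI[of _ ys]) blast
next
  case (Cons u G)
  let ?Q = "u # G @ M"
  let ?w = "last M"
  have l3: "3 \<le> length ys" "distinct ys" using cc_cyc[OF ys(1)] by (auto simp: cyc_def)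
  then have "3 \<le> card (set M)" using ys(2) distinct_card card_mono[of "set M" "set ys"] by fastforce
  then have lM: "3 \<le> length M" using card_length le_trans by blast
  then have Mne: "M \<noteq> []" by auto
  have wQ: "last ?Q = ?w" "?w \<in> set M" using Mne by auto
  have Q: "successively adj ?Q" "distinct ?Q" using Cons.prems(4,5) by auto
  have uw: "u \<noteq> ?w" using Q(2) wQ(2) by auto
  show ?case
  proof (cases "\<exists>zs. cyc adj zs \<and> set zs = set ?Q")
    \<comment> \<open>A cycle through the whole remaining path contains \<open>ys\<close>, so it
      inherits the chords and nothing is lost.\<close>
    case True
    then obtain zs where zs: "cyc adj zs" "set zs = set ?Q" by auto
    have "card (induced (set ys)) \<ge> card (set ys) + c" using ys(1) cc_card by (simp add: cc_iff)
    then have "cc zs" using zs ys(2) by (intro cc_extend[OF zs(1), of "set ys"]) auto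
    then show ?thesis
      by (intro exI[of _ D] exI[of _ zs]) (use Cons.prems zs in auto)
  next
    case False
    have nadj: "\<not> adj u ?w"
    proof
      assume "adj u ?w"
      then have "cyc adj ?Q" using Q wQ lM by (simp add: cyc_def insert_commute)
      then show False using False by blast
    qed
    have lt: "deg (set ?Q) u + deg (set ?Q) ?w < length ?Q"
    proof (rule ccontr)
      assume "\<not> ?thesis"
      then have "card (nbrs adj (set ?Q) (hd ?Q)) + card (nbrs adj (set ?Q) (last ?Q)) \<ge> length ?Q"
        using wQ(1) by simp
      from path_crossing[OF adj_sym adj_irrefl Q _ this] lM False show False by auto
    qed
    let ?U = "\<Union>j\<in>J. set (D j)"
    have VU: "V = ?U \<union> set ?Q" and dUQ: "?U \<inter> set ?Q = {}" using Cons.prems(3,6) by auto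
    have degV: "deg V a = (\<Sum>j\<in>J. deg (set (D j)) a) + deg (set ?Q) a" for a
      unfolding VU using Cons.prems(2) dUQ J(1) by (subst deg_Un) (auto simp: deg_UN)
    have cV: "card V = (\<Sum>j\<in>J. length (D j)) + length ?Q"
    proof -
      have "card ?U = (\<Sum>j\<in>J. card (set (D j)))" using Cons.prems(2) J(1) by (intro card_UN_disjoint) auto
      then have "card ?U = (\<Sum>j\<in>J. length (D j))" using Cons.prems(1) by (simp add: cc_card)
      moreover have "card (set ?Q) = length ?Q" using Q(2) by (rule distinct_card)
      ultimately show ?thesis unfolding VU using dUQ J(1) by (subst card_Un_disjoint) auto
    qed
    have "card V \<le> deg V u + deg V ?w"
      using ore[OF _ _ uw nadj] VU wQ(2) by auto
    then have gt: "(\<Sum>j\<in>J. length (D j)) < (\<Sum>j\<in>J. deg (set (D j)) u) + (\<Sum>j\<in>J. deg (set (D j)) ?w)"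
      using lt unfolding degV cV by linarith
    \<comment> \<open>The far end sees at most half of each cycle, so \<open>u\<close> must see more
      than half of one of them and is insertible there by \<open>avoids_deg\<close>.\<close>
    have "\<exists>j\<in>J. length (D j) < 2 * deg (set (D j)) u"
    proof (rule ccontr)
      assume "\<not> ?thesis"
      then have "(\<Sum>j\<in>J. 2 * deg (set (D j)) u) \<le> (\<Sum>j\<in>J. length (D j))" by (intro sum_mono) auto
      moreover have "(\<Sum>j\<in>J. 2 * deg (set (D j)) ?w) \<le> (\<Sum>j\<in>J. length (D j))"
        using Cons.prems(7) avoids_deg by (intro sum_mono) auto
      ultimately show False using gt by (simp add: sum_distrib_left[symmetric])
    qed
    then obtain j where j: "j \<in> J" "\<not> avoids u (D j)" using avoids_deg by fastforce
    have "u \<notin> set (D j)" using Cons.prems(3)[OF j(1)] by auto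
    from cc_insert[OF Cons.prems(1)[OF j(1)] this j(2)] obtain zs where
      zs: "cc zs" "set zs = insert u (set (D j))"
        "\<And>w. avoids w (D j) \<Longrightarrow> \<not> adj w u \<Longrightarrow> avoids w zs" by metis
    have nadj': "\<not> adj ?w u" using nadj by (simp add: insert_commute)
    let ?D = "D(j := zs)"
    show ?thesis
    proof (rule Cons.IH[of ?D])
      show "cc (?D i)" if "i \<in> J" for i using Cons.prems(1)[OF that] zs by auto
      show "set (?D i) \<inter> set (?D i') = {}" if "i \<in> J" "i' \<in> J" "i \<noteq> i'" for i i'
        using Cons.prems(2)[OF that] Cons.prems(3)[OF that(1)] Cons.prems(3)[OF that(2)] zs(2) that(3) by auto
      show "set (?D i) \<inter> set (G @ M) = {}" if "i \<in> J" for i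
        using Cons.prems(3)[OF that] zs(2) Q(2) by auto
      show "successively adj (G @ M)" "distinct (G @ M)" using Q by (auto simp: successively_Cons)
      show "V = (\<Union>j\<in>J. set (?D j)) \<union> set (G @ M)"
        unfolding VU using zs(2) j(1) by (auto split: if_splits)
      show "avoids ?w (?D i)" if "i \<in> J" for i using Cons.prems(7)[OF that] zs(3) nadj' by auto
    qed
  qed
qed

definition fam :: "nat \<Rightarrow> (nat \<Rightarrow> 'a list) \<Rightarrow> bool" where
  "fam k C \<longleftrightarrow> (\<forall>i<k. cc (C i)) \<and> (\<forall>i<k. \<forall>j<k. i \<noteq> j \<longrightarrow> set (C i) \<inter> set (C j) = {})"

definition cover :: "nat \<Rightarrow> (nat \<Rightarrow> 'a list) \<Rightarrow> 'a set" where
  "cover k C = (\<Union>i<k. set (C i))"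

lemma cover_subset: "fam k C \<Longrightarrow> cover k C \<subseteq> V"
  using cc_V by (auto simp: fam_def cover_def)

text \<open>Applies \<open>absorb_prefix\<close> to the family without \<open>C i\<close>, whose
  vertices together with all uncovered ones form the path. Even in the worst case fewer vertices are
  left out than before.\<close>

lemma fam_augment:
  assumes C: "fam k C" "i < k"
    and path: "successively adj (G @ M)" "distinct (G @ M)"
    and Q: "set (G @ M) = set (C i) \<union> (V - cover k C)"
    and w: "\<And>j. j < k \<Longrightarrow> avoids (last M) (C j)"
    and ys: "cc ys" "set ys \<subseteq> set M" "card (set M - set ys) < card (V - cover k C)"
  shows "\<exists>C'. fam k C' \<and> card (cover k C) < card (cover k C')"
proof -
  let ?J = "{..<k} - {i}"
  have 1: "\<exists>D' xs. (\<forall>j\<in>?J. cc (D' j)) \<and> (\<forall>i\<in>?J. \<forall>j\<in>?J. i \<noteq> j \<longrightarrow> set (D' i) \<inter> set (D' j) = {}) \<and>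
           cc xs \<and> (\<forall>j\<in>?J. set (D' j) \<inter> set xs = {}) \<and>
           V - (set M - set ys) \<subseteq> (\<Union>j\<in>?J. set (D' j)) \<union> set xs"
  proof (rule absorb_prefix[where D = C, OF _ _ _ _ path _ _ ys(1,2)])
    show "set (C j) \<inter> set (G @ M) = {}" if "j \<in> ?J" for j
      unfolding Q using that C by (auto simp: fam_def cover_def)
    show "V = (\<Union>j\<in>?J. set (C j)) \<union> set (G @ M)"
      unfolding Q using C(2) cover_subset[OF C(1)] by (auto simp: cover_def)
  qed (use C w in \<open>auto simp: fam_def\<close>)
  then obtain D' xs where D': "\<forall>j\<in>?J. cc (D' j)" "\<forall>i\<in>?J. \<forall>j\<in>?J. i \<noteq> j \<longrightarrow> set (D' i) \<inter> set (D' j) = {}"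
    "cc xs" "\<forall>j\<in>?J. set (D' j) \<inter> set xs = {}"
    "V - (set M - set ys) \<subseteq> (\<Union>j\<in>?J. set (D' j)) \<union> set xs" by auto
  let ?C = "D'(i := xs)"
  have fam: "fam k ?C" using D'(1-4) C(2) unfolding fam_def by (auto simp: Int_commute)
  have sub: "V - (set M - set ys) \<subseteq> cover k ?C"
    using D'(5) C(2) unfolding cover_def by (force split: if_splits)
  have MV: "set M \<subseteq> V" using Q C cc_V by (auto simp: fam_def)
  have "card (V - (set M - set ys)) \<le> card (cover k ?C)"
    using sub by (intro card_mono) (auto simp: cover_def)
  moreover have "card (V - (set M - set ys)) = card V - card (set M - set ys)"
    using MV by (intro card_Diff_subset) auto
  moreover have "card (V - cover k C) = card V - card (cover k C)"
    using cover_subset[OF C(1)] finV by (intro card_Diff_subset) (auto intro: finite_subset)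
  moreover have "card (cover k C) \<le> card V" using cover_subset[OF C(1)] finV by (intro card_mono)
  ultimately show ?thesis using ys(3) fam by (intro exI[of _ ?C]) auto
qed

text \<open>A Hamiltonian cycle is cut at \<open>x\<close>; sets of one or two vertices carry no
  cycle and are treated by hand.\<close>

lemma ore_path_from:
  assumes X: "X \<subseteq> V" "x \<in> X"
    and oreX: "\<And>u v. u \<in> X \<Longrightarrow> v \<in> X \<Longrightarrow> u \<noteq> v \<Longrightarrow> \<not> adj u v \<Longrightarrow> card X \<le> deg X u + deg X v"
  obtains P where "successively adj P" "distinct P" "set P = X" "P \<noteq> []" "hd P = x"
proof -
  have fin: "finite X" using X finV finite_subset by auto
  consider "card X = 1" | "card X = 2" | "3 \<le> card X"
    using X(2) fin by (metis One_nat_def Suc_1 Suc_leI card_gt_0_iff empty_iff le_neq_implies_less numeral_3_eq_3)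
  then show ?thesis
  proof cases
    case 1
    then have "X = {x}" using X(2) by (metis card_1_singletonE singletonD)
    then show ?thesis by (intro that[of "[x]"]) auto
  next
    case 2
    then obtain w where w: "X = {x, w}" "x \<noteq> w" using X(2) by (metis card_2_iff doubleton_eq_iff insertE singletonD)
    have "adj x w"
    proof (rule ccontr)
      assume n: "\<not> adj x w"
      have "nbrs adj X x = {}" "nbrs adj X w = {}"
        using w n adj_neq[of x x] adj_neq[of w w] adj_commute[of x w] by (auto simp: nbrs_def)
      then show False using oreX[of x w] w n 2 by simp
    qed
    then show ?thesis using w by (intro that[of "[x, w]"]) auto
  next
    case 3
    obtain ys where "cyc adj ys" "set ys = X" using ore_cyc[OF adj_sym adj_irrefl fin 3 oreX] by auto
    then obtain zs where "cyc adj zs" "set zs = X" "hd zs = x" using cyc_rotate_hd X(2) by metis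
    then show ?thesis by (intro that[of zs]) (auto simp: cyc_def)
  qed
qed

end

section \<open>A family of maximal coverage covers everything\<close>

context ore_graph
begin

text \<open>Extremal argument: any uncovered vertex of a family with maximal coverage leads to a
  path to which \<open>fam_augment\<close> applies.\<close>

lemma fam_cover_all:
  assumes k: "0 < k" and c: "0 < c" and C0: "fam k C0"
    and D: "\<And>v. v \<in> V \<Longrightarrow> 2 * c * k + 2 * c + 3 \<le> deg V v"
  shows "\<exists>C. fam k C \<and> cover k C = V"
proof -
  have bound: "\<forall>C. fam k C \<longrightarrow> card (cover k C) < Suc (card V)"
    using cover_subset finV by (auto intro!: card_mono simp: less_Suc_eq_le)
  obtain C where C: "fam k C" and max: "\<And>C'. fam k C' \<Longrightarrow> card (cover k C') \<le> card (cover k C)"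
    using ex_has_greatest_nat[of "fam k" C0 "\<lambda>C. card (cover k C)" "Suc (card V)"] C0 bound
    by (metis less_imp_le)
  define R where "R = V - cover k C"
  have finR: "finite R" using finV by (simp add: R_def)
  have RV: "R \<subseteq> V" by (auto simp: R_def)
  have no: False if "fam k C'" "card (cover k C) < card (cover k C')" for C'
    using max[OF that(1)] that(2) by linarith
  have ccC: "cc (C i)" if "i < k" for i using C that by (simp add: fam_def)
  have disj: "set (C i) \<inter> set (C j) = {}" if "i < k" "j < k" "i \<noteq> j" for i j
    using C that by (simp add: fam_def)
  have CR: "set (C i) \<inter> R = {}" if "i < k" for i using that by (auto simp: R_def cover_def)
  have av: "avoids x (C i)" if x: "x \<in> R" and i: "i < k" for x i
  proof (rule ccontr)
    assume n: "\<not> avoids x (C i)"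
    have "x \<notin> set (C i)" using CR[OF i] x by auto
    from cc_insert[OF ccC[OF i] this n] obtain zs where zs: "cc zs" "set zs = insert x (set (C i))" by metis
    let ?C = "C(i := zs)"
    have "fam k ?C" using C i zs CR x unfolding fam_def by (auto simp: Int_commute)
    moreover have "cover k ?C = insert x (cover k C)" using zs i by (auto simp: cover_def split: if_splits)
    moreover have "x \<notin> cover k C" "finite (cover k C)" using x by (auto simp: R_def cover_def)
    ultimately show False using no[of ?C] by auto
  qed
  have VU: "V = cover k C \<union> R" "cover k C \<inter> R = {}" using cover_subset[OF C] by (auto simp: R_def)
  have finC: "finite (cover k C)" by (simp add: cover_def)
  have degV: "deg V a = (\<Sum>i<k. deg (set (C i)) a) + deg R a" for a
  proof -
    have "deg V a = deg (cover k C) a + deg R a" by (subst VU(1), rule deg_Un[OF finC finR VU(2)])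
    then show ?thesis unfolding cover_def using disj by (subst (asm) deg_UN) auto
  qed
  have cardV: "card V = (\<Sum>i<k. length (C i)) + card R"
  proof -
    have "card V = card (cover k C) + card R" by (subst VU(1), rule card_Un_disjoint[OF finC finR VU(2)])
    moreover have "card (cover k C) = (\<Sum>i<k. card (set (C i)))" unfolding cover_def
      using disj by (intro card_UN_disjoint) auto
    ultimately show ?thesis using ccC by (simp add: cc_card)
  qed
  have half: "2 * (\<Sum>i<k. deg (set (C i)) x) \<le> (\<Sum>i<k. length (C i))" if "x \<in> R" for x
    unfolding sum_distrib_left using av[OF that] avoids_deg by (intro sum_mono) auto
  \<comment> \<open>Two uncovered vertices together take at most the total length of the cycles from
    their degree sum, so at least \<open>card R\<close> remains inside \<open>R\<close>.\<close>
  have oreR: "card R \<le> deg R u + deg R v" if "u \<in> R" "v \<in> R" "u \<noteq> v" "\<not> adj u v" for u v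
    using ore[OF _ _ that(3,4)] that(1,2) RV half[OF that(1)] half[OF that(2)]
    unfolding degV cardV by (fastforce simp: subset_iff)
  have "R = {}"
  proof (rule ccontr)
    assume "R \<noteq> {}"
    then obtain x0 where x0: "x0 \<in> R" by auto
    show False
    proof (cases "2 * c + 4 \<le> card R")
      case True
      obtain rs where rs: "cc rs" "set rs = R" using ore_cc[OF RV True oreR] by auto
      \<comment> \<open>Without an edge between \<open>R\<close> and the cycles, a vertex on each
        side would give a degree sum of at most n - 2, against Ore's condition.\<close>
      have "\<exists>x\<in>R. \<exists>i<k. \<exists>y\<in>set (C i). adj y x"
      proof (rule ccontr)
        assume n: "\<not> ?thesis"
        have "set (C 0) \<noteq> {}" using ccC[OF k] by (auto simp: cc_iff cyc_def)
        then obtain y where y: "y \<in> set (C 0)" unfolding ex_in_conv[symmetric] by (elim exE)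
        have yV: "y \<in> cover k C" using y k by (auto simp: cover_def)
        have "nbrs adj V x0 \<subseteq> R - {x0}" "nbrs adj V y \<subseteq> cover k C - {y}"
          using n x0 yV VU adj_neq[of x0 x0] adj_neq[of y y] by (auto simp: nbrs_def cover_def insert_commute)
        then have "deg V x0 \<le> card R - 1" "deg V y \<le> card (cover k C) - 1"
          using x0 yV finR finC by (auto dest!: card_mono[rotated])
        moreover have "card R > 0" "card (cover k C) > 0" using x0 yV finR finC by (auto simp: card_gt_0_iff)
        moreover have "card V = card (cover k C) + card R"
          by (subst VU(1), rule card_Un_disjoint[OF finC finR VU(2)])
        moreover have "card V \<le> deg V x0 + deg V y"
        proof (rule ore)
          show "x0 \<in> V" "y \<in> V" using x0 yV VU by auto
          show "x0 \<noteq> y" using x0 yV VU by auto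
          show "\<not> adj x0 y" using n x0 y k by (auto simp: insert_commute)
        qed
        ultimately show False by linarith
      qed
      then obtain x i y where xy: "x \<in> R" "i < k" "y \<in> set (C i)" "adj y x" by auto
      obtain ps where ps: "cyc adj ps" "set ps = R" "hd ps = x"
        using cyc_rotate_hd[OF cc_cyc[OF rs(1)]] rs(2) xy(1) by metis
      obtain as bs where ab: "C i = as @ y # bs" using xy(3) by (auto simp: in_set_conv_decomp)
      \<comment> \<open>All of \<open>C i\<close>, opened right after \<open>y\<close>, becomes the
        prefix. As \<open>rs\<close> spans exactly \<open>R\<close>, the loss is zero even if the
        whole cycle is peeled off.\<close>
      define G where "G = bs @ as @ [y]"
      have G: "cyc adj G" "set G = set (C i)"
        using cyc_rotate[of adj "as @ [y]" bs] cc_cyc[OF ccC[OF xy(2)]] by (auto simp: G_def ab)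
      have "ps \<noteq> []" using ps by (auto simp: cyc_def)
      have "\<exists>C'. fam k C' \<and> card (cover k C) < card (cover k C')"
      proof (rule fam_augment[OF C xy(2), of G ps rs])
        have "last G = y" by (simp add: G_def)
        then show "successively adj (G @ ps)"
          using G(1) ps(1,3) xy(4) by (auto simp: successively_append_iff cyc_def)
        show "distinct (G @ ps)" using G ps CR[OF xy(2)] by (auto simp: cyc_def)
        show "set (G @ ps) = set (C i) \<union> (V - cover k C)" using G ps by (auto simp: R_def)
        show "avoids (last ps) (C j)" if "j < k" for j
          using av[OF _ that] \<open>ps \<noteq> []\<close> ps(2) by auto
        show "card (set ps - set rs) < card (V - cover k C)"
          using ps(2) rs(2) finR x0 R_def by (auto simp: card_gt_0_iff)
      qed (use rs ps in auto)
      then show False using no by blast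
    next
      case False
      \<comment> \<open>At most \<open>2 * c + 2\<close> of the neighbours of \<open>x0\<close> lie
        in \<open>R\<close>, so at least \<open>2 * c * k + 1\<close> lie on the \<open>k\<close>
        cycles and one cycle holds \<open>2 * c + 1\<close> of them: one more than the ends of
        \<open>c\<close> chords.\<close>
      have "deg R x0 \<le> 2 * c + 2" using deg_less[OF finR x0] False by linarith
      then have big: "2 * c * k + 1 \<le> (\<Sum>i<k. deg (set (C i)) x0)" using D[of x0] x0 RV degV[of x0] by auto
      have "\<exists>i<k. 2 * c + 1 \<le> deg (set (C i)) x0"
      proof (rule ccontr)
        assume n: "\<not> ?thesis"
        have "(\<Sum>i<k. deg (set (C i)) x0) \<le> (\<Sum>i<k. 2 * c)" using n by (intro sum_mono) (auto simp: not_le)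
        then show False using big by (simp add: mult.commute)
      qed
      then obtain i where i: "i < k" "2 * c + 1 \<le> deg (set (C i)) x0" by auto
      have x0C: "x0 \<notin> set (C i)" using CR[OF i(1)] x0 by auto
      have "c \<le> card (chords E (C i))" using ccC[OF i(1)] by (simp add: c_chorded_cycle_def)
      then obtain K where K: "K \<subseteq> chords E (C i)" "card K = c" "finite K"
        using obtain_subset_with_card_n by metis
      have K2: "card e = 2" if "e \<in> K" for e using that K simple by (auto simp: chords_def simple_graph_def)
      have finU: "finite (\<Union>K)" using K(3) K2 by (metis card.infinite finite_Union zero_neq_numeral)
      have "card (\<Union>K) \<le> (\<Sum>e\<in>K. card e)" using card_Union_le_sum_card by auto
      then have U: "card (\<Union>K) \<le> 2 * c" using K K2 by simp
      \<comment> \<open>Adjacency off the chosen chords: a cycle for this relation cannot turn a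
        member of \<open>K\<close> into a cycle edge.\<close>
      let ?R = "\<lambda>a b. adj a b \<and> {a, b} \<notin> K"
      have "cyc ?R (C i)" using K(1) cc_cyc[OF ccC[OF i(1)]]
        by (auto simp: cyc_nth chords_def cycle_edges_def)
      moreover obtain y0 where "y0 \<in> nbrs adj (set (C i)) x0" using i(2) by fastforce
      ultimately obtain zs where zs: "cyc ?R zs" "set zs = set (C i)" "hd zs = y0" "adj x0 y0"
        using cyc_rotate_hd[of ?R "C i" y0] by (auto simp: nbrs_def)
      have dz: "distinct zs" "zs \<noteq> []" using zs by (auto simp: cyc_def)
      have cnt: "length (filter (adj x0) zs) = deg (set (C i)) x0"
        using distinct_card[of "filter (adj x0) zs"] dz(1) zs(2) by (simp add: nbrs_def)
      have "card (\<Union>K \<inter> set zs) \<le> card (\<Union>K)" using finU by (intro card_mono) auto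
      then have "card (\<Union>K \<inter> set zs) < length (filter (adj x0) zs)" using U i(2) cnt by linarith
      from exists_gap[OF dz(1) _ finU this] obtain as y G bs where
        gap: "zs = as @ y # G @ bs" "adj x0 y" "\<forall>g\<in>set G. \<not> adj x0 g \<and> g \<notin> \<Union>K" "bs = [] \<or> adj x0 (hd bs)"
        using zs(3,4) by auto
      \<comment> \<open>The rest of the cycle once the gap \<open>G\<close> is removed; both its
        ends are neighbours of \<open>x0\<close>.\<close>
      define M0 where "M0 = bs @ as @ [y]"
      have GM: "cyc ?R (G @ M0)" using zs(1) cyc_rotate[of ?R "as @ [y]" "G @ bs"] by (simp add: gap(1) M0_def)
      have sGM: "set (G @ M0) = set (C i)" using zs(2) by (auto simp: gap(1) M0_def)
      \<comment> \<open>Since \<open>c\<close> is positive, \<open>x0\<close> has several neighbours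
        on the cycle, so \<open>y\<close> with its gap is not the whole of it.\<close>
      have "bs @ as \<noteq> []"
      proof
        assume "bs @ as = []"
        then have "filter (adj x0) zs = [y]" using gap by (simp add: filter_empty_conv)
        then show False using cnt i(2) c by simp
      qed
      then have hdM: "adj x0 (hd M0)" using gap(1,4) zs(3,4) by (cases bs; cases as) (auto simp: M0_def)
      have M0: "last M0 = y" "M0 \<noteq> []" "2 \<le> length M0" "x0 \<notin> set M0"
        using \<open>bs @ as \<noteq> []\<close> x0C sGM by (auto simp: M0_def Suc_le_eq)
      obtain P where P: "successively adj P" "distinct P" "set P = R" "P \<noteq> []" "hd P = x0"
        using ore_path_from[OF RV x0 oreR] by auto
      have xK: "{a, x0} \<notin> K" "{x0, a} \<notin> K" for a using K(1) x0C by (auto simp: chords_def)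
      have yx: "adj y x0" using gap(2) by (simp add: insert_commute)
      \<comment> \<open>The fallback cycle: \<open>x0\<close> replaces the gap, and every chord in
        \<open>K\<close> survives because the gap contains no end of one.\<close>
      let ?ys = "M0 @ [x0]"
      have cys: "cyc ?R ?ys"
        using GM M0 hdM yx xK by (auto simp: cyc_def successively_append_iff)
      have KM: "K \<subseteq> chords E ?ys"
      proof
        fix e assume e: "e \<in> K"
        have "e \<subseteq> set ?ys" using e K(1) gap(3) sGM by (fastforce simp: chords_def)
        moreover have "e \<notin> cycle_edges ?ys" using cys e by (auto simp: cyc_nth cycle_edges_def simp del: length_append)
        ultimately show "e \<in> chords E ?ys" using e K(1) by (auto simp: chords_def)
      qed
      have "cyc adj ?ys" using cys by (rule cyc_mono) auto
      moreover have "c \<le> card (chords E ?ys)" using card_mono[OF _ KM] K(2) finE by (auto simp: chords_def)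
      ultimately have ccys: "cc ?ys" by (simp add: c_chorded_cycle_def is_cycle_iff)
      have "\<exists>C'. fam k C' \<and> card (cover k C) < card (cover k C')"
      proof (rule fam_augment[OF C i(1), of G "M0 @ P" ?ys])
        have "successively adj (G @ M0)" using GM cyc_mono[OF GM, of adj] by (auto simp: cyc_def)
        then show "successively adj (G @ M0 @ P)"
          using M0 P yx by (auto simp: successively_append_iff)
        show "distinct (G @ M0 @ P)" using GM sGM P CR[OF i(1)] by (auto simp: cyc_def)
        show "set (G @ M0 @ P) = set (C i) \<union> (V - cover k C)" using sGM P by (auto simp: R_def)
        show "avoids (last (M0 @ P)) (C j)" if "j < k" for j
          using av[OF _ that] P by auto
        show "set ?ys \<subseteq> set (M0 @ P)" using P x0 by auto
        \<comment> \<open>The fallback covers \<open>x0\<close> in addition, so it leaves out at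
          most \<open>card R - 1\<close> vertices.\<close>
        have "set (M0 @ P) - set ?ys \<subseteq> R - {x0}" using P by auto
        then have "card (set (M0 @ P) - set ?ys) \<le> card (R - {x0})" using finR by (intro card_mono) auto
        also have "\<dots> < card R" using finR x0 by (rule card_Diff1_less)
        finally show "card (set (M0 @ P) - set ?ys) < card (V - cover k C)" by (simp add: R_def)
      qed (rule ccys)
      then show False using no by blast
    qed
  qed
  then show ?thesis using C VU by (intro exI[of _ C]) auto
qed

end

subsection \<open>Initial families and vertices of small degree\<close>

text \<open>Every survivor next to a deleted vertex lies in \<open>A\<close>, so each bypass joins
  two elements of \<open>A\<close>. The second conjunct carries the induction through runs of
  deleted vertices.\<close>

lemma successively_filter_bypass:
  assumes "successively (\<lambda>a b. R a b \<and> (a \<in> S \<longrightarrow> b \<in> A) \<and> (b \<in> S \<longrightarrow> a \<in> A)) xs" "distinct xs"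
  shows "successively (\<lambda>a b. R a b \<or> (a \<in> A \<and> b \<in> A \<and> a \<noteq> b)) (filter (\<lambda>v. v \<notin> S) xs) \<and>
    (xs \<noteq> [] \<longrightarrow> hd xs \<in> S \<longrightarrow> filter (\<lambda>v. v \<notin> S) xs \<noteq> [] \<longrightarrow> hd (filter (\<lambda>v. v \<notin> S) xs) \<in> A)"
  using assms
proof (induction xs)
  case (Cons a xs)
  show ?case
  proof (cases xs)
    case (Cons b ys)
    let ?f = "filter (\<lambda>v. v \<notin> S) xs"
    have IH: "successively (\<lambda>a b. R a b \<or> (a \<in> A \<and> b \<in> A \<and> a \<noteq> b)) ?f"
      "hd xs \<in> S \<Longrightarrow> ?f \<noteq> [] \<Longrightarrow> hd ?f \<in> A"
      using Cons.IH Cons.prems \<open>xs = b # ys\<close> by (auto simp: successively_Cons)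
    have ab: "R a b" "a \<in> S \<Longrightarrow> b \<in> A" "b \<in> S \<Longrightarrow> a \<in> A"
      using Cons.prems \<open>xs = b # ys\<close> by auto
    have nb: "b \<notin> S \<Longrightarrow> ?f \<noteq> [] \<and> hd ?f = b" using \<open>xs = b # ys\<close> by simp
    have na: "?f \<noteq> [] \<Longrightarrow> a \<noteq> hd ?f" using Cons.prems(2) by (metis distinct.simps(2) filter_is_subset hd_in_set subsetD)
    show ?thesis
    proof (cases "a \<in> S")
      case True
      then show ?thesis using IH ab nb \<open>xs = b # ys\<close> by (cases "b \<in> S") auto
    next
      case False
      have "?f \<noteq> [] \<Longrightarrow> R a (hd ?f) \<or> (a \<in> A \<and> hd ?f \<in> A \<and> a \<noteq> hd ?f)"
        using IH(2) ab nb na \<open>xs = b # ys\<close> by (cases "b \<in> S") auto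
      then show ?thesis using False IH(1) by (auto simp: successively_Cons)
    qed
  qed auto
qed auto

lemma equal_partition:
  assumes "finite S" "card S = m * p"
  shows "\<exists>f. (\<forall>j<m. card (f j) = p) \<and> (\<forall>i<m. \<forall>j<m. i \<noteq> j \<longrightarrow> f i \<inter> f j = {}) \<and> (\<Union>j<m. f j) = (S :: 'a set)"
  using assms
proof (induction m arbitrary: S)
  case (Suc m)
  obtain T where T: "T \<subseteq> S" "card T = m * p" "finite T"
    using obtain_subset_with_card_n[of "m * p" S] Suc.prems by auto
  obtain f where f: "\<forall>j<m. card (f j) = p" "\<forall>i<m. \<forall>j<m. i \<noteq> j \<longrightarrow> f i \<inter> f j = {}" "(\<Union>j<m. f j) = T"
    using Suc.IH[OF T(3,2)] by auto
  have "card (S - T) = p" using T Suc.prems by (simp add: card_Diff_subset)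
  moreover have "f j \<inter> (S - T) = {}" "f j \<subseteq> S" if "j < m" for j using f(3) T(1) that by auto
  ultimately show ?case using f T(1)
    by (intro exI[of _ "f(m := S - T)"]) (auto simp: less_Suc_eq subset_iff)
qed auto

section \<open>Disjoint fans along a path\<close>

context graph
begin

text \<open>Trimming ends not adjacent to \<open>w\<close> loses no neighbour of \<open>w\<close>;
  once both ends are neighbours, \<open>w\<close> closes the path and \<open>cc_fan\<close>
  applies.\<close>

lemma fan_cycle:
  assumes "successively adj P" "distinct P" "w \<notin> set P" "c + 2 \<le> deg (set P) w"
  shows "\<exists>xs. cc xs \<and> set xs \<subseteq> insert w (set P)"
  using assms
proof (induction "length P" arbitrary: P rule: less_induct)
  case less
  have "deg (set P) w \<le> length P" using deg_le[of "set P" w] distinct_card[OF less.prems(2)] by auto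
  then have l: "2 \<le> length P" using less.prems(4) by linarith
  then have ne: "P \<noteq> []" by auto
  show ?case
  proof (cases "adj w (hd P) \<and> adj w (last P)")
    case True
    have "cyc adj (w # P)" using less.prems True l ne by (auto simp: cyc_def successively_Cons insert_commute)
    moreover have "deg (set P) w \<le> deg (set (w # P)) w" by (intro deg_mono) auto
    ultimately have "cc (w # P)" using less.prems(4) by (intro cc_fan[of _ w]) auto
    then show ?thesis by (intro exI[of _ "w # P"]) auto
  next
    case False
    have "\<exists>Q. length Q < length P \<and> successively adj Q \<and> distinct Q \<and> set Q \<subseteq> set P \<and> nbrs adj (set Q) w = nbrs adj (set P) w"
    proof (cases "adj w (hd P)")
      case True
      then have "\<not> adj w (last P)" using False by simp
      then show ?thesis using less.prems(1,2) ne
        by (cases P rule: rev_cases) (auto simp: nbrs_def successively_append_iff)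
    next
      case False
      then show ?thesis using less.prems(1,2) ne by (cases P) (auto simp: nbrs_def successively_Cons)
    qed
    then obtain Q where Q: "length Q < length P" "successively adj Q" "distinct Q" "set Q \<subseteq> set P"
      "nbrs adj (set Q) w = nbrs adj (set P) w" by auto
    have "\<exists>xs. cc xs \<and> set xs \<subseteq> insert w (set Q)"
      using less.hyps[OF Q(1-3)] Q(4,5) less.prems(3,4) by auto
    then show ?thesis using Q(4) by blast
  qed
qed

text \<open>Greedy choice: the shortest prefix on which some apex has \<open>c + 2\<close>
  neighbours is spent on that apex, and each other apex loses at most \<open>c + 2\<close>
  neighbours with it.\<close>

lemma disjoint_fans:
  assumes "finite W" "successively adj P" "distinct P" "W \<inter> set P = {}"
    and "\<And>w. w \<in> W \<Longrightarrow> card W * (c + 2) \<le> deg (set P) w"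
  shows "\<exists>F. (\<forall>w\<in>W. cc (F w) \<and> set (F w) \<subseteq> insert w (set P)) \<and>
           (\<forall>v\<in>W. \<forall>w\<in>W. v \<noteq> w \<longrightarrow> set (F v) \<inter> set (F w) = {})"
  using assms
proof (induction "card W" arbitrary: W P)
  case 0
  then show ?case by auto
next
  case (Suc m)
  define good where "good = (\<lambda>p. \<exists>w\<in>W. c + 2 \<le> deg (set (take p P)) w)"
  obtain w1 where w1: "w1 \<in> W" using Suc.hyps(2) by fastforce
  have "c + 2 \<le> card W * (c + 2)" using Suc.hyps(2)[symmetric] by simp
  then have "good (length P)" unfolding good_def using Suc.prems(5)[OF w1] w1 by (intro bexI[of _ w1]) auto
  define p where "p = (LEAST p. good p)"
  have p: "good p" unfolding p_def by (rule LeastI) fact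
  have notp: "\<not> good q" if "q < p" for q using not_less_Least that unfolding p_def by blast
  obtain w0 where w0: "w0 \<in> W" "c + 2 \<le> deg (set (take p P)) w0" using p by (auto simp: good_def)
  have "p \<noteq> 0" using w0 by (intro notI) (simp add: nbrs_def)
  then obtain q where q: "p = Suc q" by (cases p) auto
  \<comment> \<open>One vertex earlier every apex still had fewer than \<open>c + 2\<close>
    neighbours, by minimality of \<open>p\<close>.\<close>
  have le: "deg (set (take p P)) w \<le> c + 2" if "w \<in> W" for w
  proof -
    have "deg (set (take q P)) w < c + 2" using notp[of q] q that by (auto simp: good_def not_le)
    moreover have "set (take p P) \<subseteq> set (take q P) \<union> {P ! q}"
      unfolding q by (cases "q < length P") (auto simp: take_Suc_conv_app_nth)
    then have "nbrs adj (set (take p P)) w \<subseteq> insert (P ! q) (nbrs adj (set (take q P)) w)"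
      by (auto simp: nbrs_def)
    then have "deg (set (take p P)) w \<le> card (insert (P ! q) (nbrs adj (set (take q P)) w))"
      by (intro card_mono) (auto simp: nbrs_def)
    then have "deg (set (take p P)) w \<le> Suc (deg (set (take q P)) w)"
      using card_insert_le_m1 by (metis (no_types, lifting) card_insert_if finite_insert le_SucI le_trans linorder_linear card.infinite)
    ultimately show ?thesis by linarith
  qed
  have dP: "set P = set (take p P) \<union> set (drop p P)" "set (take p P) \<inter> set (drop p P) = {}"
    using set_append[of "take p P" "drop p P"] set_take_disj_set_drop_if_distinct[OF Suc.prems(3)] by auto
  have pP: "successively adj (take p P)" "successively adj (drop p P)"
    using Suc.prems(2) successively_append_iff[of adj "take p P" "drop p P"] by auto
  obtain xs where xs: "cc xs" "set xs \<subseteq> insert w0 (set (take p P))"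
    using fan_cycle[OF pP(1) _ _ w0(2)] Suc.prems(3,4) w0(1) dP(1) by (auto simp: distinct_take)
  let ?W = "W - {w0}"
  have cW: "card ?W = m" using Suc.hyps(2) Suc.prems(1) w0(1) by simp
  have "\<exists>F. (\<forall>w\<in>?W. cc (F w) \<and> set (F w) \<subseteq> insert w (set (drop p P))) \<and>
           (\<forall>v\<in>?W. \<forall>w\<in>?W. v \<noteq> w \<longrightarrow> set (F v) \<inter> set (F w) = {})"
  proof (rule Suc.hyps(1))
    show "m = card ?W" "finite ?W" "successively adj (drop p P)" "distinct (drop p P)"
      using cW Suc.prems(1,3) pP by auto
    show "?W \<inter> set (drop p P) = {}" using Suc.prems(4) dP(1) by auto
    fix w assume w: "w \<in> ?W"
    have "deg (set P) w = deg (set (take p P)) w + deg (set (drop p P)) w"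
      by (subst dP(1), rule deg_Un) (use dP(2) in auto)
    moreover have "card W * (c + 2) \<le> deg (set P) w" using Suc.prems(5) w by auto
    moreover have "card W * (c + 2) = card ?W * (c + 2) + (c + 2)" unfolding Suc.hyps(2)[symmetric] cW by simp
    ultimately show "card ?W * (c + 2) \<le> deg (set (drop p P)) w" using le[of w] w by auto
  qed
  then obtain F where F: "\<forall>w\<in>?W. cc (F w) \<and> set (F w) \<subseteq> insert w (set (drop p P))"
    "\<forall>v\<in>?W. \<forall>w\<in>?W. v \<noteq> w \<longrightarrow> set (F v) \<inter> set (F w) = {}" by auto
  have dis: "set xs \<inter> set (F w) = {}" if "w \<in> ?W" for w
    using that F(1) xs(2) dP Suc.prems(4) w0(1) by blast
  show ?case
  proof (intro exI[of _ "F(w0 := xs)"] conjI ballI impI)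
    fix w assume "w \<in> W"
    then show "cc ((F(w0 := xs)) w)" using F(1) xs(1) by auto
    show "set ((F(w0 := xs)) w) \<subseteq> insert w (set P)" using \<open>w \<in> W\<close> F(1) xs(2) dP(1) by auto
  next
    fix v w assume "v \<in> W" "w \<in> W" "v \<noteq> w"
    then show "set ((F(w0 := xs)) v) \<inter> set ((F(w0 := xs)) w) = {}"
      using F(2) dis by (auto simp: Int_commute)
  qed
qed

end

section \<open>An initial family, and the case of a vertex of small degree\<close>

context ore_graph
begin

text \<open>The first \<open>k\<close> vertices of a Hamiltonian cycle serve as apexes and the rest
  as the path. Each apex has at most \<open>k\<close> neighbours among the apexes, leaving
  \<open>k * (c + 2)\<close> on the path.\<close>

lemma initial_fam:
  assumes V: "3 \<le> card V" and d: "\<And>v. v \<in> V \<Longrightarrow> c * k + 3 * k \<le> deg V v"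
  shows "\<exists>C. fam k C"
proof -
  obtain H where H: "cyc adj H" "set H = V" using ore_cyc[OF adj_sym adj_irrefl finV V ore] by auto
  define W where "W = set (take k H)"
  let ?P = "drop k H"
  have dH: "distinct H" "successively adj H" using H(1) by (auto simp: cyc_def)
  obtain v where v: "v \<in> V" using V by fastforce
  have "k \<le> card V" using d[OF v] deg_le[OF finV, of v] by linarith
  then have k: "k \<le> length H" using H(2) distinct_card[OF dH(1)] by simp
  have cW: "card W = k" unfolding W_def using distinct_card[OF distinct_take[OF dH(1)]] k by simp
  have VU: "V = W \<union> set ?P" "W \<inter> set ?P = {}"
    using H(2) set_append[of "take k H" "drop k H"] set_take_disj_set_drop_if_distinct[OF dH(1), of k k]
    by (simp_all add: W_def)
  have "\<exists>F. (\<forall>w\<in>W. cc (F w) \<and> set (F w) \<subseteq> insert w (set ?P)) \<and>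
           (\<forall>v\<in>W. \<forall>w\<in>W. v \<noteq> w \<longrightarrow> set (F v) \<inter> set (F w) = {})"
  proof (rule disjoint_fans)
    show "successively adj ?P" using dH(2) successively_append_iff[of adj "take k H" ?P] by auto
    fix w assume "w \<in> W"
    then have "c * k + 3 * k \<le> deg V w" using d VU by auto
    also have "deg V w = deg W w + deg (set ?P) w" by (subst VU(1), rule deg_Un) (use VU(2) in \<open>simp_all add: W_def\<close>)
    also have "deg W w \<le> k" using deg_le[of W w] cW by (simp add: W_def)
    finally show "card W * (c + 2) \<le> deg (set ?P) w" unfolding cW by (simp add: algebra_simps)
  qed (use dH VU(2) in \<open>simp_all add: W_def\<close>)
  then obtain F where F: "\<forall>w\<in>W. cc (F w)" "\<forall>v\<in>W. \<forall>w\<in>W. v \<noteq> w \<longrightarrow> set (F v) \<inter> set (F w) = {}" by auto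
  have W: "H ! i \<in> W" if "i < k" for i unfolding W_def using that k by (auto simp: in_set_conv_nth intro!: exI[of _ i])
  have "fam k (\<lambda>i. F (H ! i))" unfolding fam_def
    using F W k dH(1) by (auto simp: nth_eq_iff_index_eq)
  then show ?thesis by auto
qed

text \<open>All non-neighbours of a vertex of small degree \<open>d\<close> miss fewer than \<open>d\<close> vertices. Any \<open>2D\<close> of
  them span a chorded cycle, and bypassing those whose Hamiltonian neighbours are of the same kind
  leaves a graph that is Hamiltonian after adding edges that the closure allows.\<close>

lemma partition_low_degree:
  assumes x: "x \<in> V" "deg V x < D" and D: "c + 2 \<le> D" "(2 * k + 1) * D \<le> card V" and k: "0 < k"
  shows "\<exists>C. fam k C \<and> cover k C = V"
proof -
  let ?n = "card V"
  let ?d = "deg V x"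
  \<comment> \<open>The budget: \<open>k - 1\<close> sets of size \<open>2 * D\<close>, and
    \<open>3 * D\<close> vertices in reserve, which bounds the excluded set \<open>B\<close> and
    later guarantees the size of the remainder.\<close>
  have k1: "(2 * k + 1) * D = (k - 1) * (2 * D) + 3 * D" using k by (cases k) (auto simp: algebra_simps)
  have n3: "3 \<le> ?n" using D k1 by (simp add: algebra_simps)
  define A where "A = {u \<in> V. u \<noteq> x \<and> \<not> adj x u}"
  have AV: "A \<subseteq> V" by (auto simp: A_def)
  have VA: "card (V - A) \<le> D"
  proof -
    have "V - A \<subseteq> insert x (nbrs adj V x)" by (auto simp: A_def nbrs_def)
    then have "card (V - A) \<le> card (insert x (nbrs adj V x))"
      using finV by (intro card_mono) (auto simp: nbrs_def)
    also have "\<dots> \<le> Suc ?d" using finV by (simp add: card_insert_if nbrs_def)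
    finally show ?thesis using x(2) by simp
  qed
  \<comment> \<open>A member of \<open>A\<close> misses at most \<open>deg V x\<close> vertices of
    \<open>V\<close>, itself included, hence no more of any \<open>X\<close>.\<close>
  have degA: "card X \<le> deg X u + ?d" if "u \<in> A" "X \<subseteq> V" for u X
  proof -
    have fX: "finite X" using that finV finite_subset by auto
    have "?n \<le> deg V x + deg V u" using that x(1) by (intro ore) (auto simp: A_def)
    also have "deg V u = deg (X \<union> (V - X)) u" using that(2) by (simp add: Un_absorb1)
    also have "\<dots> = deg X u + deg (V - X) u" using fX finV by (intro deg_Un) auto
    also have "deg (V - X) u \<le> card (V - X)" using finV by (intro deg_le) auto
    finally have "?n \<le> deg V x + (deg X u + card (V - X))" by simp
    moreover have "card (V - X) = ?n - card X" "card X \<le> ?n"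
      using that(2) fX finV by (auto simp: card_Diff_subset card_mono)
    ultimately show ?thesis by linarith
  qed
  obtain H0 where "cyc adj H0" "set H0 = V"
    using ore_cyc[OF adj_sym adj_irrefl finV n3 ore] by auto
  \<comment> \<open>Starting at \<open>x\<close>, which is outside \<open>A\<close>, ensures that
    neither end of the list \<open>H\<close> is deleted below.\<close>
  then obtain H where H: "cyc adj H" "set H = V" "hd H = x" using cyc_rotate_hd x(1) by metis
  have dH: "distinct H" "3 \<le> length H" and lH: "length H = ?n"
    using H distinct_card[of H] by (auto simp: cyc_def)
  let ?s = "\<lambda>i. (i + 1) mod ?n"
  have s_lt: "?s i < ?n" for i using n3 by (intro mod_less_divisor) auto
  have s_inj: "inj_on ?s {..<?n}"
  proof (rule inj_onI)
    fix i j assume ij: "i \<in> {..<?n}" "j \<in> {..<?n}" "?s i = ?s j"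
    then have "(if Suc i < ?n then Suc i else 0) = (if Suc j < ?n then Suc j else 0)" "i < ?n" "j < ?n"
      using Suc_mod_eq[of i ?n] Suc_mod_eq[of j ?n] by simp_all
    then show "i = j" by (simp split: if_splits)
  qed
  define I0 where "I0 = {i. i < ?n \<and> H ! i \<notin> A}"
  define I1 where "I1 = {i. i < ?n \<and> H ! ?s i \<notin> A}"
  have fin: "finite I0" "finite I1" by (auto simp: I0_def I1_def)
  have "(\<lambda>i. H ! i) ` I0 \<subseteq> V - A" unfolding I0_def using H(2) lH by auto
  then have "card ((\<lambda>i. H ! i) ` I0) \<le> card (V - A)" using finV by (intro card_mono) auto
  moreover have "inj_on (\<lambda>i. H ! i) I0" using dH lH by (auto simp: inj_on_def I0_def nth_eq_iff_index_eq)
  ultimately have I0: "card I0 \<le> D" using VA by (simp add: card_image)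
  have "inj_on ?s I1" by (rule inj_on_subset[OF s_inj]) (auto simp: I1_def)
  moreover have "?s ` I1 \<subseteq> I0" using s_lt by (auto simp: I0_def I1_def)
  ultimately have I1: "card I1 \<le> D" using card_inj_on_le[of ?s I1 I0] fin I0 by linarith
  \<comment> \<open>The vertices that are outside \<open>A\<close>, or whose predecessor or
    successor on \<open>H\<close> is outside \<open>A\<close>.\<close>
  define B where "B = (\<lambda>i. H ! i) ` I0 \<union> (\<lambda>i. H ! ?s i) ` I0 \<union> (\<lambda>i. H ! i) ` I1"
  have "card B \<le> card ((\<lambda>i. H ! i) ` I0) + card ((\<lambda>i. H ! ?s i) ` I0) + card ((\<lambda>i. H ! i) ` I1)"
    unfolding B_def by (meson card_Un_le add_le_mono1 le_trans)
  also have "\<dots> \<le> 3 * D"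
    using card_image_le[OF fin(1), of "\<lambda>i. H ! i"] card_image_le[OF fin(1), of "\<lambda>i. H ! ?s i"]
      card_image_le[OF fin(2), of "\<lambda>i. H ! i"] I0 I1 by linarith
  finally have B: "card B \<le> 3 * D" .
  have "card V - card B \<le> card (V - B)" by (rule diff_card_le_card_Diff) (auto simp: B_def fin)
  then have "(k - 1) * (2 * D) \<le> card (V - B)" using B D(2) k1 by linarith
  then obtain S where S: "S \<subseteq> V - B" "card S = (k - 1) * (2 * D)" "finite S"
    using obtain_subset_with_card_n by metis
  have SA: "S \<subseteq> A"
  proof
    fix v assume v: "v \<in> S"
    then obtain i where "i < ?n" "H ! i = v" using S(1) H(2) lH by (metis DiffD1 in_set_conv_nth subsetD)
    then show "v \<in> A" using v S(1) by (auto simp: B_def I0_def)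
  qed
  obtain f where f: "\<forall>j<k-1. card (f j) = 2 * D" "\<forall>i<k-1. \<forall>j<k-1. i \<noteq> j \<longrightarrow> f i \<inter> f j = {}" "(\<Union>j<k-1. f j) = S"
    using equal_partition[OF S(3,2)] by auto
  have "\<exists>xs. cc xs \<and> set xs = f j" if j: "j < k - 1" for j
  proof -
    have fA: "f j \<subseteq> A" using f(3) j SA by auto
    have cf: "card (f j) = 2 * D" using f(1) j by simp
    have fV: "f j \<subseteq> V" and ge: "2 * c + 4 \<le> card (f j)" using fA AV cf D(1) by auto
    \<comment> \<open>Each of the two degrees is at least \<open>2 * D - deg V x\<close>, which
      exceeds \<open>D\<close>.\<close>
    have oref: "card (f j) \<le> deg (f j) u + deg (f j) v" if "u \<in> f j" "v \<in> f j" for u v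
      using degA[of u, OF _ fV] degA[of v, OF _ fV] that fA cf x(2) by fastforce
    obtain xs where "cc xs" "set xs = f j" using ore_cc[OF fV ge oref] by blast
    then show ?thesis by blast
  qed
  then obtain g where g: "\<And>j. j < k - 1 \<Longrightarrow> cc (g j) \<and> set (g j) = f j" by metis
  let ?X = "V - S"
  have SV: "S \<subseteq> V" using SA AV by auto
  have "card ?X = ?n - card S" using SV S(3) by (rule card_Diff_subset[rotated])
  then have cX: "3 * D \<le> card ?X" using S(2) D(2) k1 by linarith
  have finX: "finite ?X" using finV by auto
  let ?R = "\<lambda>a b. adj a b \<and> (a \<in> S \<longrightarrow> b \<in> A) \<and> (b \<in> S \<longrightarrow> a \<in> A)"
  let ?R' = "\<lambda>a b. adj a b \<or> (a \<in> A \<and> b \<in> A \<and> a \<noteq> b)"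
  have HR: "cyc ?R H"
    unfolding cyc_nth
  proof (intro conjI allI impI)
    fix i assume i: "i < length H"
    then show "adj (H ! i) (H ! ((i + 1) mod length H))" using H(1) by (auto simp: cyc_nth)
    show "H ! ((i + 1) mod length H) \<in> A" if "H ! i \<in> S"
    proof (rule ccontr)
      assume "H ! ((i + 1) mod length H) \<notin> A"
      then have "H ! i \<in> B" using i lH by (auto simp: B_def I1_def)
      then show False using that S(1) by auto
    qed
    show "H ! i \<in> A" if "H ! ((i + 1) mod length H) \<in> S"
    proof (rule ccontr)
      assume "H ! i \<notin> A"
      then have "H ! ((i + 1) mod length H) \<in> B" using i lH by (auto simp: B_def I0_def)
      then show False using that S(1) by auto
    qed
  qed (use dH in auto)
  let ?F = "filter (\<lambda>v. v \<notin> S) H"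
  have Hne: "H \<noteq> []" using dH by auto
  have xA: "x \<notin> A" by (auto simp: A_def)
  have lastS: "last H \<notin> S" using HR H(3) xA by (auto simp: cyc_def)
  have xS: "x \<notin> S" using xA SA by auto
  have ends: "hd ?F = x" "last ?F = last H"
  proof -
    show "hd ?F = x" using H(3) Hne xS by (cases H) auto
    show "last ?F = last H" using Hne lastS by (cases H rule: rev_cases) auto
  qed
  have sF: "set ?F = ?X" using H(2) by auto
  have "cyc ?R' ?F"
    unfolding cyc_def
  proof (intro conjI)
    have "length ?F = card ?X" using distinct_card[of ?F] dH(1) sF by simp
    then show "3 \<le> length ?F" using cX D(1) by linarith
    show "distinct ?F" using dH by simp
    show "successively ?R' ?F"
      using successively_filter_bypass[of adj S A H] HR dH by (auto simp: cyc_def)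
    show "?R' (last ?F) (hd ?F)" unfolding ends using HR H(3) by (auto simp: cyc_def)
  qed
  moreover have "symp ?R'" using adj_sym by (auto simp: symp_def)
  \<comment> \<open>Both degrees are at least \<open>card ?X - deg V x\<close>, and
    \<open>card ?X\<close> exceeds twice \<open>deg V x\<close>, so the closure admits every pair
    inside \<open>A\<close>.\<close>
  moreover have "card ?X \<le> deg ?X u + deg ?X v" if "u \<in> A" "v \<in> A" for u v
    using degA[OF that(1), of ?X] degA[OF that(2), of ?X] cX x(2) by auto
  ultimately obtain ys where ys: "cyc adj ys" "set ys = ?X"
    using cyc_closure[OF adj_sym adj_irrefl finX _ _ sF, of ?R'] by auto
  \<comment> \<open>A surviving member of \<open>A\<close> has large degree in the remainder and
    supplies the chords of the last cycle.\<close>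
  have "?X \<inter> A \<noteq> {}"
  proof
    assume "?X \<inter> A = {}"
    then have "card ?X \<le> card (V - A)" using finV by (intro card_mono) auto
    then show False using VA cX D(1) by linarith
  qed
  then obtain u where u: "u \<in> ?X" "u \<in> A" by auto
  have "c + 2 \<le> deg ?X u" using degA[OF u(2), of ?X] cX x(2) D(1) by auto
  then have cys: "cc ys" using cc_fan[OF ys(1), of u] u ys(2) by auto
  let ?C = "\<lambda>j. if j < k - 1 then g j else ys"
  have gS: "set (g j) \<subseteq> S" if "j < k - 1" for j using g[OF that] f(3) that by auto
  have "fam k ?C"
    unfolding fam_def
  proof (intro conjI allI impI)
    fix i j assume ij: "i < k" "j < k" "i \<noteq> j"
    show "set (?C i) \<inter> set (?C j) = {}"
      using ij f(2) g gS[of i] gS[of j] ys(2) by (cases "i < k - 1"; cases "j < k - 1") auto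
  qed (use g cys in auto)
  moreover have "cover k ?C = V"
  proof -
    have "cover k ?C = (\<Union>j<k-1. set (g j)) \<union> set ys"
      unfolding cover_def using k by (cases k) (auto simp: lessThan_Suc)
    also have "(\<Union>j<k-1. set (g j)) = S" using g f(3) by auto
    finally show ?thesis using ys(2) SV by auto
  qed
  ultimately show ?thesis by auto
qed

end

section \<open>From sigma_2 to Ore's condition, and the arithmetic of the bound\<close>

lemma ore_graph_sigma2:
  assumes "simple_graph V E" "sigma2 V E \<ge> enat (card V)"
  shows "ore_graph V E"
proof -
  interpret graph V E c by unfold_locales (rule assms)
  have deg: "degree V E u = deg V u" for u by (simp add: degree_def nbrs_def insert_commute)
  show ?thesis
  proof unfold_locales
    fix u v assume uv: "u \<in> V" "v \<in> V" "u \<noteq> v" "{u, v} \<notin> E"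
    have "enat (card V) \<le> enat (degree V E (fst (u, v)) + degree V E (snd (u, v)))"
      using uv assms(2) unfolding sigma2_def by (elim order_trans, intro INF_lower) auto
    then show "card V \<le> deg V u + deg V v" by (simp add: deg)
  qed
qed

theorem theorem1:
  fixes V :: "'a set" and E :: "'a set set" and k c :: nat
  assumes "k \<ge> 1" and "c \<ge> 1"
    and "simple_graph V E"
    and "int (card V) \<ge> f_bound k c"
    and "sigma2 V E \<ge> enat (card V)"
  shows "\<exists>Cs :: 'a list list. length Cs = k \<and>
           (\<forall>i < k. c_chorded_cycle c V E (Cs ! i)) \<and>
           (\<forall>i < k. \<forall>j < k. i \<noteq> j \<longrightarrow> set (Cs ! i) \<inter> set (Cs ! j) = {}) \<and>
           (\<Union>i < k. set (Cs ! i)) = V"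
proof -
  interpret ore_graph V E c by (rule ore_graph_sigma2) fact+
  have "\<exists>C. fam k C \<and> cover k C = V"
  proof (cases "k = 1")
    case True
    \<comment> \<open>For \<open>k = 1\<close> the bound is \<open>20 * c - 3\<close>, and the whole
      graph is the one cycle.\<close>
    then have "2 * c + 4 \<le> card V" using assms(2,4) by (simp add: f_bound_def)
    from ore_cc[OF subset_refl this ore] obtain xs where "cc xs" "set xs = V" by auto
    then show ?thesis using True by (intro exI[of _ "\<lambda>_. xs"]) (auto simp: fam_def cover_def)
  next
    case False
    then have k: "2 \<le> k" using assms(1) by simp
    \<comment> \<open>The first term is the degree required by \<open>fam_cover_all\<close>, the
      second that required by \<open>initial_fam\<close>.\<close>
    define D where "D = max (2 * c * k + 2 * c + 3) (c * k + 3 * k)"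
    \<comment> \<open>The monomials of the bound are replaced by independent variables, making the
      comparison linear.\<close>
    have arith: "0 \<le> 4 * X + 4 * Y - 10 * K - 2" "0 \<le> 6 * X + 9 * Y - 6 * Z - 7 * K + 2 * int c + 1"
      if "2 * Y \<le> X" "Z \<le> X" "K \<le> Y" "2 \<le> K" for X Y Z K :: int
      using that by linarith+
    let ?X = "int c * (int k * int k)" and ?Y = "int c * int k" and ?Z = "int k * int k"
    have Z: "2 * int k \<le> ?Z" and Y: "int k \<le> ?Y" using k assms(2) by simp_all
    have "int c * (2 * int k) \<le> ?X" using Z by (intro mult_left_mono) auto
    then have X: "2 * ?Y \<le> ?X" "?Z \<le> ?X"
      using assms(2) mult_right_mono[of 1 "int c" ?Z] by simp_all
    have "f_bound k c - int ((2 * k + 1) * (2 * c * k + 2 * c + 3)) = 4 * ?X + 4 * ?Y - 10 * int k - 2"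
      "f_bound k c - int ((2 * k + 1) * (c * k + 3 * k)) = 6 * ?X + 9 * ?Y - 6 * ?Z - 7 * int k + 2 * int c + 1"
      by (simp_all add: f_bound_def power2_eq_square algebra_simps)
    moreover have "0 \<le> 4 * ?X + 4 * ?Y - 10 * int k - 2" "0 \<le> 6 * ?X + 9 * ?Y - 6 * ?Z - 7 * int k + 2 * int c + 1"
      using arith[OF X Y] k by simp_all
    ultimately have "int ((2 * k + 1) * (2 * c * k + 2 * c + 3)) \<le> f_bound k c"
      "int ((2 * k + 1) * (c * k + 3 * k)) \<le> f_bound k c"
      by (metis diff_ge_0_iff_ge)+
    then have "(2 * k + 1) * (2 * c * k + 2 * c + 3) \<le> card V" "(2 * k + 1) * (c * k + 3 * k) \<le> card V"
      using assms(4) by (metis of_nat_le_iff order_trans)+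
    then have n: "(2 * k + 1) * D \<le> card V" unfolding D_def max_def by presburger
    show ?thesis
    proof (cases "\<exists>x\<in>V. deg V x < D")
      case True
      then show ?thesis using partition_low_degree[OF _ _ _ n] k by (auto simp: D_def)
    next
      case False
      have "D \<le> (2 * k + 1) * D" by simp
      then have "3 \<le> card V" using n by (simp add: D_def)
      moreover have d: "c * k + 3 * k \<le> deg V v" "2 * c * k + 2 * c + 3 \<le> deg V v" if "v \<in> V" for v
        using False that by (auto simp: D_def not_less)
      ultimately obtain C where "fam k C" using initial_fam by blast
      from fam_cover_all[OF _ _ this d(2)] show ?thesis using assms(1,2) by simp
    qed
  qed
  then obtain C where C: "fam k C" "cover k C = V" by auto
  then show ?thesis
    by (intro exI[of _ "map C [0..<k]"]) (auto simp: fam_def cover_def)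
qed

end
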